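(* Let $T>0$, $L\ge1$, $\alpha>0$, $\Lambda\in\mathbb{R}^{n_s\times n_s}$, $B\in\mathbb{R}^{n_s\times n_u}$, $C\in\mathbb{R}^{n_y\times n_s}$, and assume that (a) $\|\Lambda\|,\|B\|,\|C\|\le L$; (b) $(\Lambda,B)$ is $(L,\alpha)$-stabilizable; (c) $(\Lambda,C)$ is $(L,\alpha)$-detectable. Let $n_z=2n_s+n_u$. Then for any intervals $I_1,I_2\subseteq[0,T]$, any $p(\cdot)=(q(\cdot),r(\cdot),d(\cdot))\in L^2([0,T];\mathbb{R}^{n_z})$ and any $\overline{s},\overline{\lambda}\in\mathbb{R}^{n_s}$, the mild solution $z^\star(\cdot)=(s^\star(\cdot),u^\star(\cdot),\lambda^\star(\cdot))=H^{-1}(p(\cdot),\overline{s},\overline{\lambda})$ satisfies $$\left[\int_{I_1}\|z^\star(t)\|_2^2dt\right]^{1/2}\le 8D\Bigg\{e^{-\frac{d(I_1,0)}{4D}}\|\overline{s}\|_2+e^{-\frac{d(I_1,T)}{4D}}\|\overline{\lambda}\|_2+e^{-\frac{d(I_1,I_2)}{4D}}\left[\int_{I_2}\|p(t)\|_2^2dt\right]^{1/2}+e^{-\frac{d(I_1,[0,T]\setminus I_2)}{4D}}\left[\int_{[0,T]\setminus I_2}\|p(t)\|_2^2dt\right]^{1/2}\Bigg\},$$ where $d(\cdot,\cdot)$ with two set or point arguments is the Euclidean distance on $[0,T]$, and $$D:=\frac{L(1+2L)\left(\alpha^2+L^4(1+L)^2\right)^{1/2}}{\alpha^2}+\frac{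L^2(1+2L)^2}{\alpha^2}\max\left(1,\frac{L^2(1+L)^2}{(1+2L)^2}\right).$$
   Context: Matrix norms are spectral norms. A matrix $\Phi\in\mathbb{R}^{n_s\times n_s}$ is $(L,\alpha)$-stable if $\|e^{\Phi t}\|\le Le^{-\alpha t}$ for all $t\ge0$. $(\Lambda,B)$ is $(L,\alpha)$-stabilizable if there is $K\in\mathbb{R}^{n_u\times n_s}$ with $\|K\|\le L$ and $\Lambda-BK$ $(L,\alpha)$-stable. $(\Lambda,C)$ is $(L,\alpha)$-detectable if there is $K\in\mathbb{R}^{n_s\times n_y}$ with $\|K\|\le L$ and $\Lambda-KC$ $(L,\alpha)$-stable. The setting is the linear-quadratic optimal control problem of minimizing over $s:[0,T]\to\mathbb{R}^{n_s}$, $u:[0,T]\to\mathbb{R}^{n_u}$ the cost $\int_0^T\big(\tfrac12\|Cs(t)\|_2^2+\tfrac12\|u(t)\|_2^2-q(t)^\top s(t)-r(t)^\top u(t)\big)dt-\overline{\lambda}^\top s(T)$ subject to $s(0)=\overline{s}$, $\dot s(t)=\Lambda s(t)+Bu(t)+d(t)$. Here $q(\cdot)$ and $d(\cdot)$ take values in $\mathbb{R}^{n_s}$ and $r(\cdot)$ in $\mathbb{R}^{n_u}$. Its stationarity conditions are $$C^\top Cs-\dot\lambda-\Lambda^\top\lambda=q,\quad u-B^\top\lambda=r,\quad \dot s-\Lambda s-Bu=d,\quad s(0)=\overline{s},\quad \lambda(T)=\overline{\lambda}.$$ $H^{-1}$ denotes the bounded linear solution map $L^2([0,T];\mathbb{R}^{n_z})\times\mathbb{R}^{n_s}\times\mathbb{R}^{n_s}\to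 L^2([0,T];\mathbb{R}^{n_z})$ sending $(p,\overline{s},\overline{\lambda})$ to the solution $z^\star=(s^\star,u^\star,\lambda^\star)$ of these conditions in the mild sense, i.e. for $t\in[0,T]$: $$\lambda^\star(t)=\int_t^Te^{\Lambda^\top(\tau-t)}\big(q(\tau)-C^\top Cs^\star(\tau)\big)d\tau+e^{\Lambda^\top(T-t)}\overline{\lambda},$$ $$u^\star(t)=r(t)+B^\top\lambda^\star(t),$$ $$s^\star(t)=e^{\Lambda t}\overline{s}+\int_0^te^{\Lambda(t-\tau)}\big(Bu^\star(\tau)+d(\tau)\big)d\tau.$$ The distance between two sets is the infimum of distances between their points; a term whose integral is over the empty set is zero. *)

theory Defs
  imports "HOL-Analysis.Analysis"
begin

text \<open>The library norm on \<^typ>\<open>real^'n^'m\<close> is the Frobenius norm, so the spectral norm is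
  written as the operator norm of the induced map between Euclidean spaces.\<close>

definition spectral_norm :: "real^'n^'m \<Rightarrow> real" where
  "spectral_norm A = onorm (\<lambda>x. A *v x)"

primrec matrix_power :: "real^'n^'n \<Rightarrow> nat \<Rightarrow> real^'n^'n" where
  "matrix_power A 0 = mat 1"
| "matrix_power A (Suc k) = A ** matrix_power A k"

definition matrix_exp :: "real^'n^'n \<Rightarrow> real^'n^'n" where
  "matrix_exp A = (\<Sum>k. (1 / fact k) *\<^sub>R matrix_power A k)"

definition stable :: "real \<Rightarrow> real \<Rightarrow> real^'s^'s \<Rightarrow> bool" where
  "stable L \<alpha> \<Phi> \<longleftrightarrow>
     (\<forall>t\<ge>0. spectral_norm (matrix_exp (t *\<^sub>R \<Phi>)) \<le> L * exp (- \<alpha> * t))"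

definition stabilizable :: "real \<Rightarrow> real \<Rightarrow> real^'s^'s \<Rightarrow> real^'u^'s \<Rightarrow> bool" where
  "stabilizable L \<alpha> \<Lambda> B \<longleftrightarrow>
     (\<exists>K :: real^'s^'u. spectral_norm K \<le> L \<and> stable L \<alpha> (\<Lambda> - B ** K))"

definition detectable :: "real \<Rightarrow> real \<Rightarrow> real^'s^'s \<Rightarrow> real^'s^'y \<Rightarrow> bool" where
  "detectable L \<alpha> \<Lambda> C \<longleftrightarrow>
     (\<exists>K :: real^'y^'s. spectral_norm K \<le> L \<and> stable L \<alpha> (\<Lambda> - K ** C))"

definition L2_on :: "real set \<Rightarrow> (real \<Rightarrow> 'a::euclidean_space) \<Rightarrow> bool" where
  "L2_on S f \<longleftrightarrow>
     set_borel_measurable lebesgue S f \<and> set_integrable lebesgue S (\<lambda>t. (norm (f t))\<^sup>2)"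

definition L2_norm_on :: "real set \<Rightarrow> (real \<Rightarrow> 'a::euclidean_space) \<Rightarrow> real" where
  "L2_norm_on S f = sqrt (LINT t:S|lebesgue. (norm (f t))\<^sup>2)"

text \<open>Vectors of dimension \<open>n\<^sub>z = 2 n\<^sub>s + n\<^sub>u\<close> are triples in
  \<^typ>\<open>(real^'s) \<times> (real^'u) \<times> (real^'s)\<close>; the product norm is the Euclidean norm of the
  concatenated vector.

  The graph of the solution map: \<open>mild_solution T \<Lambda> B C q r d s\<^sub>0 l\<^sub>T s u l\<close> says that
  \<open>(s, u, l) = H\<^sup>-\<^sup>1((q, r, d), s\<^sub>0, l\<^sub>T)\<close>. Square integrability of \<open>(s, u, l)\<close> and of the
  data makes all integrals below genuine ones.\<close>

definition mild_solution ::
  "real \<Rightarrow> real^'s^'s \<Rightarrow> real^'u^'s \<Rightarrow> real^'s^'y \<Rightarrow>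
   (real \<Rightarrow> real^'s) \<Rightarrow> (real \<Rightarrow> real^'u) \<Rightarrow> (real \<Rightarrow> real^'s) \<Rightarrow> real^'s \<Rightarrow> real^'s \<Rightarrow>
   (real \<Rightarrow> real^'s) \<Rightarrow> (real \<Rightarrow> real^'u) \<Rightarrow> (real \<Rightarrow> real^'s) \<Rightarrow> bool" where
  "mild_solution T \<Lambda> B C q r d s\<^sub>0 l\<^sub>T s u l \<longleftrightarrow>
     L2_on {0..T} (\<lambda>t. (s t, u t, l t)) \<and>
     (\<forall>t\<in>{0..T}.
        l t = (LINT \<tau>:{t..T}|lebesgue.
                 matrix_exp ((\<tau> - t) *\<^sub>R transpose \<Lambda>) *v (q \<tau> - (transpose C ** C) *v s \<tau>))
              + matrix_exp ((T - t) *\<^sub>R transpose \<Lambda>) *v l\<^sub>T \<and>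
        u t = r t + transpose B *v l t \<and>
        s t = matrix_exp (t *\<^sub>R \<Lambda>) *v s\<^sub>0
              + (LINT \<tau>:{0..t}|lebesgue.
                   matrix_exp ((t - \<tau>) *\<^sub>R \<Lambda>) *v (B *v u \<tau> + d \<tau>)))"

definition decay_const :: "real \<Rightarrow> real \<Rightarrow> real" where
  "decay_const L \<alpha> =
     L * (1 + 2 * L) * sqrt (\<alpha>\<^sup>2 + L ^ 4 * (1 + L)\<^sup>2) / \<alpha>\<^sup>2
     + L\<^sup>2 * (1 + 2 * L)\<^sup>2 / \<alpha>\<^sup>2 * max 1 (L\<^sup>2 * (1 + L)\<^sup>2 / (1 + 2 * L)\<^sup>2)"

end

theory Submission
  imports Defs
begin

text \<open>The theorem is an exponentially weighted version of one global estimate. Write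
  \<open>z = (s, u, l)\<close> for the solution and \<open>p = (q, r, d)\<close> for the data.

  The global estimate is \<open>\<parallel>z\<parallel> \<le> 2 D \<parallel>p\<parallel> + 4 D (|s(0)| + |l(T)|)\<close> in \<open>L\<^sup>2([0,T])\<close>
  (\<open>stationarity_L2_estimate\<close>). Differentiating the pairing of state and adjoint gives the energy
  identity: \<open>\<parallel>C s\<parallel>\<^sup>2 + \<parallel>u\<parallel>\<^sup>2\<close> equals boundary terms plus a pairing of \<open>p\<close> with \<open>z\<close>
  (\<open>stationarity_energy\<close>). In the other direction, the energy controls \<open>z\<close>. By detectability there
  is an output injection \<open>K\<close> such that \<open>\<Lambda> - K C\<close> is stable, and \<open>s\<close> solves the equation of this
  stable system with forcing \<open>K C s + B u + d\<close>; by stabilizability, \<open>l\<close> solves a stable equation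
  backwards in time with forcing \<open>K\<^sup>T B\<^sup>T l + q - C\<^sup>T C s\<close>, where \<open>B\<^sup>T l = u - r\<close>. So
  \<open>\<parallel>z\<parallel>\<close> is at most linear in the square root of the energy, in \<open>\<parallel>p\<parallel>\<close> and in the boundary data, and
  the energy is at most \<open>\<parallel>p\<parallel> \<parallel>z\<parallel>\<close> plus boundary terms; the quadratic inequality is then solved for
  \<open>\<parallel>z\<parallel>\<close> (\<open>saddle_point_bound\<close>). That the resulting constants are below multiples of \<open>D\<close> uses
  \<open>\<alpha> \<le> L (1 + L)\<close>: a matrix cannot be stable with a rate exceeding its norm.

  For the decay, let \<open>w(t) = exp (- dist(t, I\<^sub>1) / (4 D))\<close>. The weighted solution \<open>w z\<close> satisfies the
  same stationarity conditions with data \<open>w p\<close> plus terms \<open>w' s\<close> and \<open>- w' l\<close>, whose norm is at most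
  \<open>\<parallel>w z\<parallel> / (4 D)\<close>. Half of \<open>\<parallel>w z\<parallel>\<close> is thus absorbed in the global estimate, which leaves
  \<open>\<parallel>w z\<parallel> \<le> 4 D \<parallel>w p\<parallel> + 8 D (w(0) |s(0)| + w(T) |l(T)|)\<close>
  (\<open>weighted_stationarity_estimate\<close>). Since \<open>w = 1\<close> on \<open>I\<^sub>1\<close> and \<open>w \<le> exp (- d(I\<^sub>1, X) / (4 D))\<close>
  on every set \<open>X\<close>, this is the claim.

  The data are only square integrable, so the differential equations hold in the sense of
  indefinite integrals. Their calculus rests on a product rule
  (\<open>primitive_on_product\<close>), which yields variation of constants, the energy identity, the decay
  estimate for stable systems and the equations of the weighted solution.\<close>

section \<open>Indefinite integrals and their product rule\<close>

text \<open>The Lebesgue-integral form of \<open>f' = g\<close> on \<open>[0,T]\<close>, that is, absolute continuity of \<open>f\<close> with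
  derivative \<open>g\<close>; it makes no reference to pointwise derivatives, which need not exist everywhere.\<close>

definition primitive_on :: "real \<Rightarrow> (real \<Rightarrow> 'a::euclidean_space) \<Rightarrow> (real \<Rightarrow> 'a) \<Rightarrow> bool" where
  "primitive_on T f f' \<longleftrightarrow>
     f' absolutely_integrable_on {0..T} \<and> (\<forall>t\<in>{0..T}. f t = f 0 + integral {0..t} f')"

lemma primitive_on_eq:
  assumes "primitive_on T f f'" and "t \<in> {0..T}"
  shows "f t = f 0 + integral {0..t} f'"
  using assms unfolding primitive_on_def by blast

lemma primitive_on_cong:
  assumes "primitive_on T f f'"
    and "\<And>t. t \<in> {0..T} \<Longrightarrow> g t = f t" and "\<And>t. t \<in> {0..T} \<Longrightarrow> g' t = f' t"
  shows "primitive_on T g g'"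
  unfolding primitive_on_def
proof (intro conjI ballI)
  show "g' absolutely_integrable_on {0..T}"
  proof (rule absolutely_integrable_spike[where f=f' and S="{}"])
    show "f' absolutely_integrable_on {0..T}"
      using assms(1) by (simp add: primitive_on_def)
  qed (use assms(3) in auto)
next
  fix t assume t: "t \<in> {0..T}"
  have "integral {0..t} g' = integral {0..t} f'"
    using t assms(3) by (intro integral_cong) auto
  then show "g t = g 0 + integral {0..t} g'"
    using t assms(2)[of t] assms(2)[of 0] primitive_on_eq[OF assms(1) t] by simp
qed

lemma primitive_on_integrable:
  assumes "primitive_on T f f'" and "0 \<le> x" "y \<le> T"
  shows "f' integrable_on {x..y}"
proof -
  have "f' integrable_on {0..T}"
    using assms by (simp add: primitive_on_def absolutely_integrable_on_def)
  then show ?thesis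
    by (rule integrable_subinterval_real) (use assms in auto)
qed

lemma primitive_on_increment:
  assumes "primitive_on T f f'" and "0 \<le> x" "x \<le> y" "y \<le> T"
  shows "(f' has_integral (f y - f x)) {x..y}"
proof -
  have "integral {0..x} f' + integral {x..y} f' = integral {0..y} f'"
    using assms primitive_on_integrable[OF assms(1), of 0 y]
    by (intro Henstock_Kurzweil_Integration.integral_combine) auto
  moreover have "f x = f 0 + integral {0..x} f'" "f y = f 0 + integral {0..y} f'"
    using assms primitive_on_eq[OF assms(1)] by (metis atLeastAtMost_iff order_trans)+
  ultimately have "integral {x..y} f' = f y - f x"
    by (metis add_diff_cancel_left add_diff_cancel_left')
  then show ?thesis
    using integrable_integral[OF primitive_on_integrable[OF assms(1,2,4)]] by simp
qed

lemma primitive_onI: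
  assumes "f' absolutely_integrable_on {0..T}"
    and "\<And>t. t \<in> {0..T} \<Longrightarrow> (f' has_integral (f t - f 0)) {0..t}"
  shows "primitive_on T f f'"
  unfolding primitive_on_def
proof (intro conjI ballI)
  show "f t = f 0 + integral {0..t} f'" if "t \<in> {0..T}" for t
    using integral_unique[OF assms(2)[OF that]] by simp
qed (fact assms(1))

lemma primitive_on_continuous:
  assumes "primitive_on T f f'"
  shows "continuous_on {0..T} f"
proof -
  have "f' integrable_on {0..T}"
    using assms by (simp add: primitive_on_def absolutely_integrable_on_def)
  then have "continuous_on {0..T} (\<lambda>t. f 0 + integral {0..t} f')"
    by (intro continuous_intros indefinite_integral_continuous_1)
  moreover have "continuous_on {0..T} f \<longleftrightarrow> continuous_on {0..T} (\<lambda>t. f 0 + integral {0..t} f')"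
    by (intro continuous_on_cong refl primitive_on_eq[OF assms])
  ultimately show ?thesis by simp
qed

lemma absolutely_integrable_bounded_bilinear:
  fixes h :: "'a::euclidean_space \<Rightarrow> 'b::euclidean_space \<Rightarrow> 'c::euclidean_space"
  assumes "bounded_bilinear h" and "continuous_on {a..b::real} f" and "g absolutely_integrable_on {a..b}"
  shows "(\<lambda>t. h (f t) (g t)) absolutely_integrable_on {a..b}"
proof (rule absolutely_integrable_bounded_measurable_product[where h=h and f=f and g=g])
  show "bilinear h" using assms(1) by (simp add: bilinear_conv_bounded_bilinear)
  show "f \<in> borel_measurable (lebesgue_on {a..b})"
    using assms(2) by (intro continuous_imp_measurable_on_sets_lebesgue) auto
  show "bounded (f ` {a..b})"
    using assms(2) by (intro compact_imp_bounded compact_continuous_image) auto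
qed (use assms in auto)

lemma primitive_on_C1:
  assumes "continuous_on {0..T} f'" 
    and "\<And>t. t \<in> {0..T} \<Longrightarrow> (f has_vector_derivative f' t) (at t)"
  shows "primitive_on T f f'"
proof (rule primitive_onI)
  show "f' absolutely_integrable_on {0..T}"
    using assms by (intro absolutely_integrable_continuous_real)
  show "(f' has_integral (f t - f 0)) {0..t}" if "t \<in> {0..T}" for t
    using that assms by (intro fundamental_theorem_of_calculus)
      (auto intro: has_vector_derivative_at_within)
qed

text \<open>An additive bound for short increments extends to the whole interval by walking in short steps.\<close>

lemma small_increments_imp_bound:
  fixes F :: "real \<Rightarrow> 'a::real_normed_vector" and M :: "real \<Rightarrow> real"
  assumes "\<delta> > 0"
    and local: "\<And>x y. \<lbrakk>a \<le> x; x \<le> y; y \<le> b; y - x \<le> \<delta>\<rbrakk> \<Longrightarrow> norm (F y - F x) \<le> M y - M x"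
    and "a \<le> b"
  shows "norm (F b - F a) \<le> M b - M a"
proof -
  have "a \<le> x \<Longrightarrow> x \<le> y \<Longrightarrow> y \<le> b \<Longrightarrow> y - x \<le> real n * \<delta> \<Longrightarrow> norm (F y - F x) \<le> M y - M x" for n x y
  proof (induction n arbitrary: x y)
    case 0
    then show ?case using local[of x y] \<open>\<delta> > 0\<close> by auto
  next
    case (Suc n)
    define m where "m = max x (y - \<delta>)"
    have "norm (F y - F m) \<le> M y - M m"
      using Suc.prems \<open>\<delta> > 0\<close> by (intro local) (auto simp: m_def)
    moreover have "norm (F m - F x) \<le> M m - M x"
      using Suc.prems \<open>\<delta> > 0\<close> by (intro Suc.IH) (auto simp: m_def algebra_simps max_def)
    moreover have "norm (F y - F x) \<le> norm (F y - F m) + norm (F m - F x)"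
      using norm_triangle_ineq[of "F y - F m" "F m - F x"] by simp
    ultimately show ?case by simp
  qed
  moreover obtain n where "b - a \<le> real n * \<delta>"
    using \<open>\<delta> > 0\<close> by (meson ex_less_of_nat_mult less_imp_le)
  ultimately show ?thesis using \<open>a \<le> b\<close> by blast
qed

text \<open>The increment of \<open>h (f t) (g t)\<close> over a short interval \<open>[x,y]\<close> is exactly the integral of
  \<open>h (f' \<tau>) (g y) + h (f x) (g' \<tau>)\<close>. By uniform continuity, replacing \<open>g y\<close> and \<open>f x\<close> by
  \<open>g \<tau>\<close> and \<open>f \<tau>\<close> costs at most a small multiple of the integral of \<open>\<parallel>f'\<parallel> + \<parallel>g'\<parallel>\<close> over \<open>[x,y]\<close>. These errors
  add up to an arbitrarily small multiple of the integral over \<open>[0,t]\<close>.\<close>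

lemma primitive_on_product:
  fixes h :: "'a::euclidean_space \<Rightarrow> 'b::euclidean_space \<Rightarrow> 'c::euclidean_space"
  assumes h: "bounded_bilinear h" and f: "primitive_on T f f'" and g: "primitive_on T g g'"
  shows "primitive_on T (\<lambda>t. h (f t) (g t)) (\<lambda>t. h (f' t) (g t) + h (f t) (g' t))"
    (is "primitive_on T ?p ?p'")
proof (rule primitive_onI)
  interpret h: bounded_bilinear h by fact
  have h': "bounded_bilinear (\<lambda>y x. h x y)" by (rule h.flip)
  note cf = primitive_on_continuous[OF f] and cg = primitive_on_continuous[OF g]
  have f': "f' absolutely_integrable_on {0..T}" and g': "g' absolutely_integrable_on {0..T}"
    using f g by (auto simp: primitive_on_def)
  have i1: "(\<lambda>t. h (f' t) (g t)) absolutely_integrable_on {0..T}"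
    using absolutely_integrable_bounded_bilinear[OF h' cg f'] .
  have i2: "(\<lambda>t. h (f t) (g' t)) absolutely_integrable_on {0..T}"
    using absolutely_integrable_bounded_bilinear[OF h cf g'] .
  show i: "?p' absolutely_integrable_on {0..T}"
    using i1 i2 by (rule set_integral_add)
  fix t assume t: "t \<in> {0..T}"
  define m where "m \<tau> = norm (f' \<tau>) + norm (g' \<tau>)" for \<tau>
  have im: "m integrable_on {x..y}" if "0 \<le> x" "y \<le> T" for x y
  proof -
    have "m integrable_on {0..T}"
      unfolding m_def using f' g' by (intro integrable_add) (auto simp: absolutely_integrable_on_def)
    then show ?thesis by (rule integrable_subinterval_real) (use that in auto)
  qed
  have ip: "?p' integrable_on {x..y}" if "0 \<le> x" "y \<le> T" for x y
  proof -
    have "?p' integrable_on {0..T}"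
      using i by (auto simp: absolutely_integrable_on_def)
    then show ?thesis by (rule integrable_subinterval_real) (use that in auto)
  qed
  \<comment> \<open>The defect of the product rule, to be shown constant.\<close>
  define F where "F x = ?p x - integral {0..x} ?p'" for x
  obtain K where K: "K > 0" "\<And>x y. norm (h x y) \<le> norm x * norm y * K"
    using h.pos_bounded by blast
  have bound: "norm (F t - F 0) \<le> e * K * integral {0..t} m" if "e > 0" for e
  proof -
    have "uniformly_continuous_on {0..T} f" "uniformly_continuous_on {0..T} g"
      using cf cg by (auto intro: compact_uniformly_continuous)
    then obtain d1 d2 where d: "d1 > 0" "d2 > 0"
      "\<And>x y. \<lbrakk>x\<in>{0..T}; y\<in>{0..T}; dist y x < d1\<rbrakk> \<Longrightarrow> dist (f y) (f x) < e"
      "\<And>x y. \<lbrakk>x\<in>{0..T}; y\<in>{0..T}; dist y x < d2\<rbrakk> \<Longrightarrow> dist (g y) (g x) < e"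
      unfolding uniformly_continuous_on_def using \<open>e > 0\<close> by metis
    define \<delta> where "\<delta> = min d1 d2 / 2"
    have "\<delta> > 0" using d by (simp add: \<delta>_def)
    have "norm (F t - F 0) \<le> e * K * integral {0..t} m - e * K * integral {0..0} m"
    proof (rule small_increments_imp_bound[OF \<open>\<delta> > 0\<close>])
      fix x y assume xy: "0 \<le> x" "x \<le> y" "y \<le> t" "y - x \<le> \<delta>"
      then have le: "0 \<le> x" "x \<le> y" "y \<le> T" using t by auto
      have a: "((\<lambda>\<tau>. h (f' \<tau>) (g y)) has_integral (h (f y - f x) (g y))) {x..y}"
        using has_integral_linear[OF primitive_on_increment[OF f le] h.bounded_linear_left[of "g y"]]
        by (simp add: o_def)
      have b: "((\<lambda>\<tau>. h (f x) (g' \<tau>)) has_integral (h (f x) (g y - g x))) {x..y}"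
        using has_integral_linear[OF primitive_on_increment[OF g le] h.bounded_linear_right[of "f x"]]
        by (simp add: o_def)
      have c: "(?p' has_integral integral {x..y} ?p') {x..y}"
        using ip[of x y] le by (simp add: integrable_integral)
      have comb: "integral {0..x} ?p' + integral {x..y} ?p' = integral {0..y} ?p'"
        using le ip[of 0 y] by (intro Henstock_Kurzweil_Integration.integral_combine) auto
      have combm: "integral {0..x} m + integral {x..y} m = integral {0..y} m"
        using le im[of 0 y] by (intro Henstock_Kurzweil_Integration.integral_combine) auto
      have "F y - F x = h (f y - f x) (g y) + h (f x) (g y - g x) - integral {x..y} ?p'"
        unfolding F_def comb[symmetric] by (simp add: h.diff_left h.diff_right)
      also have "\<dots> = integral {x..y} (\<lambda>\<tau>. h (f' \<tau>) (g y) + h (f x) (g' \<tau>) - ?p' \<tau>)"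
        using has_integral_diff[OF has_integral_add[OF a b] c] by (simp add: integral_unique)
      also have "norm \<dots> \<le> integral {x..y} (\<lambda>\<tau>. e * K * m \<tau>)"
      proof (rule integral_norm_bound_integral)
        show "(\<lambda>\<tau>. h (f' \<tau>) (g y) + h (f x) (g' \<tau>) - ?p' \<tau>) integrable_on {x..y}"
          using has_integral_diff[OF has_integral_add[OF a b] c] by blast
        show "(\<lambda>\<tau>. e * K * m \<tau>) integrable_on {x..y}"
          using im[of x y] le by (intro integrable_on_mult_right) auto
        fix \<tau> assume \<tau>: "\<tau> \<in> {x..y}"
        have "dist (g y) (g \<tau>) < e" "dist (f x) (f \<tau>) < e"
          using \<tau> xy le d(1,2) by (auto intro!: d(3,4) simp: dist_real_def \<delta>_def)
        then have "norm (h (f' \<tau>) (g y - g \<tau>)) \<le> norm (f' \<tau>) * e * K"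
          "norm (h (f x - f \<tau>) (g' \<tau>)) \<le> e * norm (g' \<tau>) * K"
          using K(1) by (auto intro!: order_trans[OF K(2)] mult_mono mult_nonneg_nonneg simp: dist_norm less_imp_le \<open>e > 0\<close>)
        then have "norm (h (f' \<tau>) (g y - g \<tau>) + h (f x - f \<tau>) (g' \<tau>)) \<le> e * K * m \<tau>"
          using norm_triangle_ineq[of "h (f' \<tau>) (g y - g \<tau>)" "h (f x - f \<tau>) (g' \<tau>)"]
          by (simp add: m_def algebra_simps)
        then show "norm (h (f' \<tau>) (g y) + h (f x) (g' \<tau>) - ?p' \<tau>) \<le> e * K * m \<tau>"
          by (simp add: h.diff_left h.diff_right algebra_simps)
      qed
      also have "\<dots> = e * K * integral {0..y} m - e * K * integral {0..x} m"
        unfolding combm[symmetric] by (simp add: algebra_simps)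
      finally show "norm (F y - F x) \<le> e * K * integral {0..y} m - e * K * integral {0..x} m" .
    qed (use t in auto)
    then show ?thesis by simp
  qed
  have "norm (F t - F 0) \<le> 0"
  proof (rule field_le_epsilon)
    fix e :: real assume "e > 0"
    define J where "J = K * integral {0..t} m"
    have "J \<ge> 0" using K(1) im[of 0 t] t by (auto simp: J_def m_def intro!: mult_nonneg_nonneg Henstock_Kurzweil_Integration.integral_nonneg)
    then have "e / (J + 1) > 0" using \<open>e > 0\<close> by simp
    from bound[OF this] have "norm (F t - F 0) \<le> e / (J + 1) * J" by (simp add: J_def)
    also have "\<dots> \<le> e" using \<open>J \<ge> 0\<close> \<open>e > 0\<close> by (simp add: field_simps)
    finally show "norm (F t - F 0) \<le> 0 + e" by simp
  qed
  then have "integral {0..t} ?p' = ?p t - ?p 0"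
    by (simp add: F_def algebra_simps)
  then show "(?p' has_integral ?p t - ?p 0) {0..t}"
    using ip[of 0 t] t by (metis atLeastAtMost_iff integrable_integral order_refl)
qed

lemma has_integral_reverse:
  fixes f :: "real \<Rightarrow> 'a::euclidean_space"
  assumes "(f has_integral i) {a..b}"
  shows "((\<lambda>x. f (c - x)) has_integral i) {c - b..c - a}"
proof (cases "a \<le> b")
  case True
  have "(\<lambda>x. c - x) ` {a..b} = {c - b..c - a}" by (simp add: image_diff_atLeastAtMost)
  then show ?thesis
    using has_integral_affinity[of f i a b "-1" c] assms True
    by (simp add: algebra_simps cong: image_cong)
next
  case False
  then show ?thesis using assms by auto
qed

lemma absolutely_integrable_reverse:
  fixes f :: "real \<Rightarrow> 'a::euclidean_space"
  assumes "f absolutely_integrable_on {0..T}"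
  shows "(\<lambda>x. f (T - x)) absolutely_integrable_on {0..T}"
proof -
  have "(\<lambda>x. g (T - x)) integrable_on {0..T}" if "g integrable_on {0..T}" for g :: "real \<Rightarrow> 'b::euclidean_space"
    using has_integral_reverse[OF integrable_integral[OF that], of T] by auto
  from this[of f] this[of "\<lambda>x. norm (f x)"] show ?thesis
    using assms by (auto simp: absolutely_integrable_on_def)
qed

text \<open>Time reversal reduces the adjoint equation, which runs backwards from \<open>T\<close>, to a forward one.\<close>

lemma primitive_on_reverse:
  assumes "primitive_on T f f'"
  shows "primitive_on T (\<lambda>t. f (T - t)) (\<lambda>t. - f' (T - t))"
proof (rule primitive_onI)
  show "(\<lambda>t. - f' (T - t)) absolutely_integrable_on {0..T}"
    using absolutely_integrable_reverse[where f=f' and T=T] assms unfolding primitive_on_def 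
    by (simp add: set_integrable_def)
  show "((\<lambda>t. - f' (T - t)) has_integral f (T - t) - f (T - 0)) {0..t}" if "t \<in> {0..T}" for t
    using has_integral_neg[OF has_integral_reverse[OF primitive_on_increment[OF assms, of "T - t" T], of T]] that
    by simp
qed

section \<open>Spectral norms and bilinearity of matrix products\<close>

lemma norm_matrix_vector_le_spectral: "norm (A *v x) \<le> spectral_norm A * norm x"
  unfolding spectral_norm_def by (intro onorm matrix_vector_mul_bounded_linear)

lemma spectral_norm_nonneg: "0 \<le> spectral_norm A"
  unfolding spectral_norm_def by (intro onorm_pos_le matrix_vector_mul_bounded_linear)

text \<open>With \<open>y = A\<^sup>T x\<close> one has \<open>|y|\<^sup>2 = \<langle>x, A y\<rangle> \<le> |x| \<parallel>A\<parallel> |y|\<close>.\<close>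

lemma norm_transpose_vector_le_spectral:
  fixes A :: "real^'n^'m"
  shows "norm (transpose A *v x) \<le> spectral_norm A * norm x"
proof (cases "transpose A *v x = 0")
  case True
  then show ?thesis by (simp add: spectral_norm_nonneg)
next
  case False
  define y where "y = transpose A *v x"
  have "norm y * norm y = x \<bullet> (A *v y)"
    unfolding y_def by (metis dot_lmul_matrix norm_eq_square power2_eq_square power2_norm_eq_inner transpose_matrix_vector)
  also have "\<dots> \<le> norm x * norm (A *v y)" by (rule norm_cauchy_schwarz)
  also have "\<dots> \<le> norm x * (spectral_norm A * norm y)"
    by (intro mult_left_mono norm_matrix_vector_le_spectral) auto
  finally have "norm y * norm y \<le> (spectral_norm A * norm x) * norm y" by (simp add: ac_simps)
  then show ?thesis using False unfolding y_def[symmetric] by simp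
qed

lemma spectral_norm_transpose_le:
  fixes A :: "real^'n^'m"
  shows "spectral_norm (transpose A) \<le> spectral_norm A"
  unfolding spectral_norm_def[of "transpose A"]
  by (rule onorm_bound[OF spectral_norm_nonneg norm_transpose_vector_le_spectral])

lemma bounded_bilinear_matrix_vector:
  "bounded_bilinear (\<lambda>(A::real^'n^'m) x. A *v x)"
  unfolding bilinear_conv_bounded_bilinear[symmetric] bilinear_def
  by (auto intro!: linearI simp: matrix_vector_mult_add_rdistrib matrix_vector_right_distrib
      matrix_vector_mult_scaleR scaleR_matrix_vector_assoc)

lemma matrix_mult_add_right_distrib: "((A::'a::semiring_1^'n^'m) + B) ** C = A ** C + B ** C"
  by (simp add: matrix_matrix_mult_def vec_eq_iff distrib_right sum.distrib)

lemma bounded_bilinear_matrix_matrix: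
  "bounded_bilinear (\<lambda>(A::real^'n^'m) (B::real^'k^'n). A ** B)"
  unfolding bilinear_conv_bounded_bilinear[symmetric] bilinear_def
  by (auto intro!: linearI simp: matrix_add_ldistrib matrix_mult_add_right_distrib
      matrix_scalar_ac scalar_matrix_assoc)

interpretation mv: bounded_bilinear "\<lambda>(A::real^'n^'m) x. A *v x"
  by (rule bounded_bilinear_matrix_vector)

interpretation mm: bounded_bilinear "\<lambda>(A::real^'n^'m) (B::real^'k^'n). A ** B"
  by (rule bounded_bilinear_matrix_matrix)

lemma spectral_norm_closed_loop:
  fixes A :: "real^'n^'n" and M :: "real^'k^'n" and N :: "real^'n^'k"
  assumes "spectral_norm A \<le> L" "spectral_norm M \<le> L" "spectral_norm N \<le> L"
  shows "spectral_norm (A - M ** N) \<le> L * (1 + L)"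
  unfolding spectral_norm_def[of "A - M ** N"]
proof (rule onorm_bound)
  have L: "0 \<le> L" using assms(1) spectral_norm_nonneg order_trans by blast
  then show "0 \<le> L * (1 + L)" by simp
  fix x
  have "norm (M *v (N *v x)) \<le> spectral_norm M * (spectral_norm N * norm x)"
    by (meson mult_left_mono norm_matrix_vector_le_spectral order_trans spectral_norm_nonneg)
  also have "\<dots> \<le> L * (L * norm x)"
    using assms L by (intro mult_mono mult_right_mono) (auto simp: spectral_norm_nonneg)
  finally have "norm (M *v (N *v x)) \<le> L * (L * norm x)" .
  moreover have "norm (A *v x) \<le> L * norm x"
    using assms(1) norm_matrix_vector_le_spectral[of A x] mult_right_mono[of _ L "norm x"] by (meson norm_ge_zero order_trans)
  moreover have "norm ((A - M ** N) *v x) \<le> norm (A *v x) + norm (M *v (N *v x))"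
    by (simp add: mv.diff_left matrix_vector_mul_assoc[symmetric] norm_triangle_ineq4)
  ultimately show "norm ((A - M ** N) *v x) \<le> L * (1 + L) * norm x"
    by (simp add: algebra_simps)
qed

lemma inner_transpose: "(transpose A *v x) \<bullet> y = x \<bullet> ((A::real^'n^'m) *v y)"
  by (metis dot_lmul_matrix transpose_matrix_vector)

section \<open>The matrix exponential and variation of constants\<close>

lemma matrix_power_scaleR: "matrix_power (t *\<^sub>R A) k = t ^ k *\<^sub>R matrix_power A k"
  by (induction k) (auto simp: mm.scaleR_left mm.scaleR_right)

lemma matrix_power_commutes: "A ** matrix_power A k = matrix_power A k ** A"
proof (induction k)
  case (Suc k)
  then show ?case by (simp add: matrix_mul_assoc)
qed simp

lemma transpose_matrix_power: "transpose (matrix_power A k) = matrix_power (transpose A) k"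
proof (induction k)
  case (Suc k)
  then show ?case by (simp add: matrix_transpose_mul) (metis matrix_power_commutes)
qed (simp add: transpose_mat)

text \<open>Matrix multiplication is bounded bilinear, so the norms of the powers grow at most geometrically
  and the exponential series dominates.\<close>

lemma summable_matrix_exp: "summable (\<lambda>k. (1 / fact k) *\<^sub>R matrix_power (A::real^'n^'n) k)"
proof -
  obtain K where K: "K > 0" "\<And>(A :: real^'n^'n) (B :: real^'n^'n). norm (A ** B) \<le> norm A * norm B * K"
    using mm.pos_bounded by blast
  define r where "r = norm A * K"
  have "norm (matrix_power A k) \<le> norm (mat 1 :: real^'n^'n) * r ^ k" for k
  proof (induction k)
    case (Suc k)
    have "norm (matrix_power A (Suc k)) \<le> norm A * norm (matrix_power A k) * K"
      unfolding matrix_power.simps by (rule K(2))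
    also have "\<dots> \<le> norm A * (norm (mat 1 :: real^'n^'n) * r ^ k) * K"
      using Suc K(1) by (intro mult_right_mono mult_left_mono) auto
    finally show ?case by (simp add: r_def ac_simps)
  qed simp
  then have "norm ((1 / fact k) *\<^sub>R matrix_power A k) \<le> norm (mat 1 :: real^'n^'n) * (r ^ k /\<^sub>R fact k)" for k
    by (simp add: field_simps)
  moreover have "summable (\<lambda>k. norm (mat 1 :: real^'n^'n) * (r ^ k /\<^sub>R fact k))"
    by (intro summable_mult summable_exp_generic)
  ultimately show ?thesis by (rule summable_comparison_test'[where N=0, rotated])
qed

lemma matrix_exp_zero [simp]: "matrix_exp (0 :: real^'n^'n) = mat 1"
proof -
  have "(1 / fact k) *\<^sub>R matrix_power (0 :: real^'n^'n) k = (if k = 0 then mat 1 else 0)" for k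
    by (cases k) (auto simp: mm.zero_left)
  then have "matrix_exp (0 :: real^'n^'n) = (\<Sum>k. if k = 0 then mat 1 else 0)"
    unfolding matrix_exp_def by simp
  also have "\<dots> = mat 1"
    using sums_single[of 0 "\<lambda>_. mat 1 :: real^'n^'n"] by (simp add: sums_iff)
  finally show ?thesis .
qed

lemma matrix_exp_commutes: "A ** matrix_exp (t *\<^sub>R A) = matrix_exp (t *\<^sub>R (A :: real^'n^'n)) ** A"
proof -
  note bl = bounded_linear.suminf[OF mm.bounded_linear_right[of A] summable_matrix_exp[of "t *\<^sub>R A"]]
  note br = bounded_linear.suminf[OF mm.bounded_linear_left[of A] summable_matrix_exp[of "t *\<^sub>R A"]]
  show ?thesis
    unfolding matrix_exp_def bl[unfolded matrix_exp_def] br[unfolded matrix_exp_def]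
    by (simp del: suminf_scaleR_left add: matrix_power_scaleR mm.scaleR_left mm.scaleR_right matrix_power_commutes)
qed

lemma transpose_matrix_exp: "matrix_exp (transpose A) = transpose (matrix_exp (A :: real^'n^'n))"
proof -
  have "bounded_linear (transpose :: real^'n^'n \<Rightarrow> _)"
    unfolding linear_conv_bounded_linear[symmetric]
    by (rule linearI) (auto simp: transpose_def vec_eq_iff)
  from bounded_linear.suminf[OF this summable_matrix_exp, of A] show ?thesis
    unfolding matrix_exp_def
    by (simp add: transpose_scalar transpose_matrix_power)
qed

text \<open>Each entry of \<open>matrix_exp (t A)\<close> is a scalar power series in \<open>t\<close>, which is differentiated termwise.\<close>

lemma matrix_exp_has_vector_derivative:
  "((\<lambda>t. matrix_exp (t *\<^sub>R A)) has_vector_derivative A ** matrix_exp (t *\<^sub>R A)) (at t)"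
  for A :: "real^'n^'n"
  unfolding has_vector_derivative_def
proof (subst has_derivative_componentwise_within, intro ballI)
  fix i :: "real^'n^'n" assume "i \<in> Basis"
  define c where "c k = (1 / fact k) * (matrix_power A k \<bullet> i)" for k
  have sums: "(\<lambda>k. c k * x ^ k) sums (matrix_exp (x *\<^sub>R A) \<bullet> i)" for x
    using bounded_linear.sums[OF bounded_linear_inner_left summable_sums[OF summable_matrix_exp[of "x *\<^sub>R A"]], of i]
    by (simp add: matrix_exp_def c_def matrix_power_scaleR ac_simps)
  have sums': "(\<lambda>k. diffs c k * x ^ k) sums ((A ** matrix_exp (x *\<^sub>R A)) \<bullet> i)" for x
  proof -
    have eq: "(A ** ((1 / fact k) *\<^sub>R matrix_power (x *\<^sub>R A) k)) \<bullet> i = diffs c k * x ^ k" for k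
      by (simp add: diffs_def c_def matrix_power_scaleR mm.scaleR_right field_simps del: of_nat_Suc)
    show ?thesis
      using bounded_linear.sums[OF bounded_linear_inner_left
          bounded_linear.sums[OF mm.bounded_linear_right summable_sums[OF summable_matrix_exp[of "x *\<^sub>R A"]]], of A i]
      unfolding matrix_exp_def[symmetric] eq .
  qed
  have "((\<lambda>x. \<Sum>k. c k * x ^ k) has_field_derivative (\<Sum>k. diffs c k * t ^ k)) (at t)"
    by (rule termdiffs_strong_converges_everywhere) (use sums in \<open>auto simp: sums_iff\<close>)
  moreover have "(\<lambda>x. \<Sum>k. c k * x ^ k) = (\<lambda>x. matrix_exp (x *\<^sub>R A) \<bullet> i)"
    "(\<Sum>k. diffs c k * t ^ k) = (A ** matrix_exp (t *\<^sub>R A)) \<bullet> i"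
    using sums sums' by (auto simp: sums_iff)
  ultimately have "((\<lambda>x. matrix_exp (x *\<^sub>R A) \<bullet> i) has_field_derivative
      (A ** matrix_exp (t *\<^sub>R A)) \<bullet> i) (at t)" by simp
  then show "((\<lambda>x. matrix_exp (x *\<^sub>R A) \<bullet> i) has_derivative (\<lambda>x. x *\<^sub>R (A ** matrix_exp (t *\<^sub>R A)) \<bullet> i)) (at t)"
    by (simp add: has_field_derivative_def mult_commute_abs)
qed

lemma continuous_on_matrix_exp:
  fixes A :: "real^'n^'n"
  assumes "continuous_on S h"
  shows "continuous_on S (\<lambda>\<tau>. matrix_exp (h \<tau> *\<^sub>R A))"
proof -
  have "continuous_on UNIV (\<lambda>t. matrix_exp (t *\<^sub>R A))"
    by (intro continuous_at_imp_continuous_on ballI)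
      (rule has_vector_derivative_continuous[OF matrix_exp_has_vector_derivative])
  from continuous_on_compose2[OF this assms] show ?thesis by simp
qed

text \<open>The derivative of the left-hand side in \<open>t\<close> vanishes. The inverse and the addition law of the
  exponential both follow from this identity.\<close>

lemma matrix_exp_shift_invariant:
  fixes A :: "real^'n^'n"
  shows "matrix_exp (- t *\<^sub>R A) ** matrix_exp ((t + s) *\<^sub>R A) = matrix_exp (s *\<^sub>R A)"
proof -
  define F where "F t = matrix_exp (- t *\<^sub>R A) ** matrix_exp ((t + s) *\<^sub>R A)" for t
  have "(F has_vector_derivative 0) (at t)" for t
  proof -
    have a: "((\<lambda>t. matrix_exp (- t *\<^sub>R A)) has_vector_derivative - (A ** matrix_exp (- t *\<^sub>R A))) (at t)"
    proof -
      have "(uminus has_vector_derivative (-1::real)) (at t)"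
        by (auto simp flip: has_real_derivative_iff_has_vector_derivative intro!: derivative_eq_intros)
      from vector_diff_chain_at[OF this matrix_exp_has_vector_derivative[of A]] show ?thesis
        by (simp add: o_def)
    qed
    have b: "((\<lambda>t. matrix_exp ((t + s) *\<^sub>R A)) has_vector_derivative A ** matrix_exp ((t + s) *\<^sub>R A)) (at t)"
    proof -
      have "((\<lambda>t. t + s) has_vector_derivative 1) (at t)"
        by (auto simp flip: has_real_derivative_iff_has_vector_derivative intro!: derivative_eq_intros)
      from vector_diff_chain_at[OF this matrix_exp_has_vector_derivative[of A]] show ?thesis
        by (simp add: o_def)
    qed
    show ?thesis
      unfolding F_def
      using bounded_bilinear.has_vector_derivative[OF bounded_bilinear_matrix_matrix a b]
      by (simp add: mm.minus_left matrix_exp_commutes[of A "-t", simplified] matrix_mul_assoc)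
  qed
  then obtain c where "\<And>t. F t = c"
    using has_vector_derivative_zero_constant[of UNIV F] by auto
  then have "F t = F 0" by simp
  then show ?thesis by (simp add: F_def)
qed

lemma matrix_exp_inverse:
  fixes A :: "real^'n^'n"
  shows "matrix_exp (t *\<^sub>R A) ** matrix_exp (- t *\<^sub>R A) = mat 1"
  using matrix_exp_shift_invariant[of "- t" A 0] by simp

lemma matrix_exp_add:
  fixes A :: "real^'n^'n"
  shows "matrix_exp ((t + s) *\<^sub>R A) = matrix_exp (t *\<^sub>R A) ** matrix_exp (s *\<^sub>R A)"
  using matrix_exp_shift_invariant[of t A s] matrix_exp_inverse[of t A]
  by (metis matrix_mul_assoc matrix_mul_lid)

lemma primitive_on_matrix_exp:
  "primitive_on T (\<lambda>t. matrix_exp (t *\<^sub>R A)) (\<lambda>t. A ** matrix_exp (t *\<^sub>R A))"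
  by (rule primitive_on_C1[OF _ matrix_exp_has_vector_derivative])
    (intro mm.continuous_on continuous_on_matrix_exp continuous_intros)

text \<open>The mild formula is \<open>matrix_exp (t A)\<close> applied to the indefinite integral
  \<open>x + \<integral>\<^sub>0\<^sup>t matrix_exp (- \<tau> A) g(\<tau>)\<close>, and the product rule differentiates it.\<close>

lemma mild_imp_primitive:
  fixes A :: "real^'n^'n"
  assumes g: "g absolutely_integrable_on {0..T}" and "0 \<le> T"
    and f: "\<And>t. t \<in> {0..T} \<Longrightarrow>
      f t = matrix_exp (t *\<^sub>R A) *v x + integral {0..t} (\<lambda>\<tau>. matrix_exp ((t - \<tau>) *\<^sub>R A) *v g \<tau>)"
  shows "primitive_on T f (\<lambda>t. A *v f t + g t)"
proof -
  define k where "k \<tau> = matrix_exp (- \<tau> *\<^sub>R A) *v g \<tau>" for \<tau>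
  define w where "w t = x + integral {0..t} k" for t
  have "continuous_on {0..T} (\<lambda>t. matrix_exp (- t *\<^sub>R A))"
    using primitive_on_continuous[OF primitive_on_matrix_exp[of T "- A"]] by simp
  then have k: "k absolutely_integrable_on {0..T}"
    unfolding k_def by (intro absolutely_integrable_bounded_bilinear[OF bounded_bilinear_matrix_vector _ g])
  have w: "primitive_on T w k"
    unfolding primitive_on_def using k by (simp add: w_def)
  have fw: "f t = matrix_exp (t *\<^sub>R A) *v w t" if t: "t \<in> {0..T}" for t
  proof -
    have "k integrable_on {0..t}" using primitive_on_integrable[OF w] t by auto
    then have "matrix_exp (t *\<^sub>R A) *v integral {0..t} k = integral {0..t} (\<lambda>\<tau>. matrix_exp (t *\<^sub>R A) *v k \<tau>)"
      by (rule integral_linear[OF _ mv.bounded_linear_right, unfolded o_def, symmetric])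
    also have "(\<lambda>\<tau>. matrix_exp (t *\<^sub>R A) *v k \<tau>) = (\<lambda>\<tau>. matrix_exp ((t - \<tau>) *\<^sub>R A) *v g \<tau>)"
      using matrix_exp_add[of t _ A, symmetric] by (simp add: k_def fun_eq_iff matrix_vector_mul_assoc flip: scaleR_minus_left)
    finally show ?thesis using f[OF t] by (simp add: w_def mv.add_right)
  qed
  show ?thesis
  proof (rule primitive_on_cong[OF primitive_on_product[OF bounded_bilinear_matrix_vector primitive_on_matrix_exp[of T A] w] fw])
    fix t assume t: "t \<in> {0..T}"
    show "A *v f t + g t = A ** matrix_exp (t *\<^sub>R A) *v w t + matrix_exp (t *\<^sub>R A) *v k t"
      using matrix_exp_inverse[of t A] by (simp add: fw[OF t] k_def matrix_vector_mul_assoc)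
  qed
qed

text \<open>By the product rule \<open>matrix_exp (- t A) f(t)\<close> has the derivative \<open>matrix_exp (- t A) g(t)\<close>.\<close>

lemma primitive_imp_mild:
  fixes A :: "real^'n^'n"
  assumes f: "primitive_on T f (\<lambda>t. A *v f t + g t)" and t: "t \<in> {0..T}"
  shows "((\<lambda>\<tau>. matrix_exp ((t - \<tau>) *\<^sub>R A) *v g \<tau>) has_integral f t - matrix_exp (t *\<^sub>R A) *v f 0) {0..t}"
proof -
  have E: "primitive_on T (\<lambda>t. matrix_exp (- t *\<^sub>R A)) (\<lambda>t. - (A ** matrix_exp (- t *\<^sub>R A)))"
    using primitive_on_matrix_exp[of T "- A"] by (simp add: mm.minus_left)
  have "primitive_on T (\<lambda>t. matrix_exp (- t *\<^sub>R A) *v f t) (\<lambda>t. matrix_exp (- t *\<^sub>R A) *v g t)"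
    by (rule primitive_on_cong[OF primitive_on_product[OF bounded_bilinear_matrix_vector E f] refl])
      (simp add: mv.minus_left mv.add_right matrix_vector_mul_assoc matrix_exp_commutes[of A "- _", simplified])
  from primitive_on_increment[OF this, of 0 t] t
  have "((\<lambda>\<tau>. matrix_exp (- \<tau> *\<^sub>R A) *v g \<tau>) has_integral matrix_exp (- t *\<^sub>R A) *v f t - f 0) {0..t}"
    by simp
  from has_integral_linear[OF this mv.bounded_linear_right[of "matrix_exp (t *\<^sub>R A)"]]
  show ?thesis
    using matrix_exp_add[of t _ A, symmetric] matrix_exp_inverse[of t A]
    by (simp add: o_def mv.diff_right matrix_vector_mul_assoc flip: scaleR_minus_left)
qed

section \<open>Square integrable functions\<close>

lemma L2_on_iff:
  assumes "S \<in> sets lebesgue"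
  shows "L2_on S f \<longleftrightarrow> f \<in> borel_measurable (lebesgue_on S) \<and> (\<lambda>t. (norm (f t))\<^sup>2) integrable_on S"
proof -
  have "S \<inter> space lebesgue \<in> sets lebesgue" using assms by simp
  from borel_measurable_restrict_space_iff[OF this, of f] show ?thesis
    unfolding L2_on_def set_borel_measurable_def
    by (simp add: absolutely_integrable_on_iff_nonneg indicator_scaleR_eq_if)
qed

lemma L2_norm_on_eq:
  assumes "L2_on S f"
  shows "L2_norm_on S f = sqrt (integral S (\<lambda>t. (norm (f t))\<^sup>2))"
  using assms unfolding L2_on_def L2_norm_on_def by (simp add: set_lebesgue_integral_eq_integral)

lemma L2_norm_on_square:
  assumes "L2_on S f"
  shows "(L2_norm_on S f)\<^sup>2 = integral S (\<lambda>t. (norm (f t))\<^sup>2)"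
proof -
  have "(\<lambda>t. (norm (f t))\<^sup>2) integrable_on S"
    using assms unfolding L2_on_def by (simp add: absolutely_integrable_on_def)
  then show ?thesis
    using assms by (simp add: L2_norm_on_eq Henstock_Kurzweil_Integration.integral_nonneg)
qed

lemma L2_norm_on_nonneg [simp]: "0 \<le> L2_norm_on S f"
  unfolding L2_norm_on_def set_lebesgue_integral_def
  by (auto intro!: Bochner_Integration.integral_nonneg)

lemma L2_norm_on_cong:
  assumes "\<And>t. t \<in> S \<Longrightarrow> f t = g t"
  shows "L2_norm_on S f = L2_norm_on S g"
proof -
  have "(\<lambda>t. indicat_real S t *\<^sub>R (norm (f t))\<^sup>2) = (\<lambda>t. indicator S t *\<^sub>R (norm (g t))\<^sup>2)"
    using assms by (auto simp: fun_eq_iff split: split_indicator)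
  then show ?thesis
    unfolding L2_norm_on_def set_lebesgue_integral_def by simp
qed

lemma L2_on_dominated:
  assumes S: "S \<in> sets lebesgue" and "f \<in> borel_measurable (lebesgue_on S)" and "L2_on S g"
    and le: "\<And>t. t \<in> S \<Longrightarrow> norm (f t) \<le> norm (g t)"
  shows "L2_on S f" and "L2_norm_on S f \<le> L2_norm_on S g"
proof -
  have g: "(\<lambda>t. (norm (g t))\<^sup>2) integrable_on S" using assms by (simp add: L2_on_iff)
  have "(\<lambda>t. (norm (f t))\<^sup>2) absolutely_integrable_on S"
    by (rule measurable_bounded_by_integrable_imp_absolutely_integrable[OF _ S g])
      (use assms in \<open>auto intro!: power_mono borel_measurable_power borel_measurable_norm\<close>)
  then have f: "(\<lambda>t. (norm (f t))\<^sup>2) integrable_on S" by (simp add: absolutely_integrable_on_def)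
  then show L: "L2_on S f" using assms by (simp add: L2_on_iff)
  show "L2_norm_on S f \<le> L2_norm_on S g"
    unfolding L2_norm_on_eq[OF L] L2_norm_on_eq[OF assms(3)]
    using le by (intro real_sqrt_le_mono integral_le f g power_mono) auto
qed

lemma L2_on_subset:
  assumes "S \<in> sets lebesgue" "A \<in> sets lebesgue" "A \<subseteq> S" and f: "L2_on S f"
  shows "L2_on A f"
proof -
  have "f \<in> borel_measurable (lebesgue_on S)" using f assms(1) by (simp add: L2_on_iff)
  then have "f \<in> borel_measurable (lebesgue_on A)" by (rule measurable_restrict_mono) fact
  moreover have "set_integrable lebesgue S (\<lambda>t. (norm (f t))\<^sup>2)" using f by (simp add: L2_on_def)
  then have "set_integrable lebesgue A (\<lambda>t. (norm (f t))\<^sup>2)"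
    by (rule set_integrable_subset) (use assms in auto)
  ultimately show ?thesis using assms(2) by (simp add: L2_on_iff absolutely_integrable_on_def)
qed

lemma L2_norm_on_mono_set:
  assumes S: "S \<in> sets lebesgue" and A: "A \<in> sets lebesgue" "A \<subseteq> S" and f: "L2_on S f"
  shows "L2_norm_on A f \<le> L2_norm_on S f"
proof -
  have fA: "L2_on A f" by (rule L2_on_subset[OF S A f])
  show ?thesis
    unfolding L2_norm_on_eq[OF fA] L2_norm_on_eq[OF f]
    using f fA S A by (intro real_sqrt_le_mono integral_subset_le) (auto simp: L2_on_iff)
qed

lemma L2_norm_on_split:
  assumes S: "S \<in> sets lebesgue" and A: "A \<in> sets lebesgue" "A \<subseteq> S" and f: "L2_on S f"
  shows "L2_norm_on S f \<le> L2_norm_on A f + L2_norm_on (S - A) f"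
proof (rule power2_le_imp_le)
  have SA: "S - A \<in> sets lebesgue" using S A by blast
  have fA: "L2_on A f" and fB: "L2_on (S - A) f"
    using L2_on_subset[OF S A f] L2_on_subset[OF S SA _ f] by auto
  have "((\<lambda>t. (norm (f t))\<^sup>2) has_integral (L2_norm_on A f)\<^sup>2 + (L2_norm_on (S - A) f)\<^sup>2) (A \<union> (S - A))"
    unfolding L2_norm_on_square[OF fA] L2_norm_on_square[OF fB]
    using fA fB A SA by (intro has_integral_Un integrable_integral) (auto simp: L2_on_iff)
  then have "(L2_norm_on S f)\<^sup>2 = (L2_norm_on A f)\<^sup>2 + (L2_norm_on (S - A) f)\<^sup>2"
    unfolding L2_norm_on_square[OF f] using A(2) by (simp add: integral_unique Un_absorb1)
  also have "\<dots> \<le> (L2_norm_on A f + L2_norm_on (S - A) f)\<^sup>2" by (simp add: power2_sum)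
  finally show "(L2_norm_on S f)\<^sup>2 \<le> (L2_norm_on A f + L2_norm_on (S - A) f)\<^sup>2" .
qed simp

lemma L2_on_scale:
  fixes f :: "real \<Rightarrow> 'a::euclidean_space"
  assumes S: "S \<in> sets lebesgue" and f: "L2_on S f"
  shows "L2_on S (\<lambda>t. c *\<^sub>R f t)" and "L2_norm_on S (\<lambda>t. c *\<^sub>R f t) = \<bar>c\<bar> * L2_norm_on S f"
proof -
  have "(\<lambda>t. c\<^sup>2 * (norm (f t))\<^sup>2) integrable_on S"
    using assms by (intro integrable_on_mult_right) (auto simp: L2_on_iff)
  then show L: "L2_on S (\<lambda>t. c *\<^sub>R f t)"
    using assms by (auto simp: L2_on_iff power_mult_distrib intro!: borel_measurable_scaleR)
  show "L2_norm_on S (\<lambda>t. c *\<^sub>R f t) = \<bar>c\<bar> * L2_norm_on S f"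
    unfolding L2_norm_on_eq[OF L] L2_norm_on_eq[OF f]
    by (simp add: power_mult_distrib real_sqrt_mult)
qed

lemma L2_on_weighted:
  fixes f :: "real \<Rightarrow> 'a::euclidean_space" and w :: "real \<Rightarrow> real"
  assumes S: "S \<in> sets lebesgue" and w: "w \<in> borel_measurable (lebesgue_on S)"
    and w01: "\<And>t. 0 \<le> w t" "\<And>t. w t \<le> 1" and f: "L2_on S f"
  shows "L2_on S (\<lambda>t. w t *\<^sub>R f t)"
proof (rule L2_on_dominated(1)[OF S _ f])
  show "(\<lambda>t. w t *\<^sub>R f t) \<in> borel_measurable (lebesgue_on S)"
    using w f S by (intro borel_measurable_scaleR) (auto simp: L2_on_iff)
  show "norm (w t *\<^sub>R f t) \<le> norm (f t)" for t
    using mult_right_mono[OF w01(2)[of t], of "norm (f t)"] w01(1)[of t] by simp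
qed

lemma L2_on_norm:
  assumes S: "S \<in> sets lebesgue" and f: "L2_on S f"
  shows "L2_on S (\<lambda>t. norm (f t))" and "L2_norm_on S (\<lambda>t. norm (f t)) = L2_norm_on S f"
  using assms unfolding L2_norm_on_def by (auto simp: L2_on_iff intro!: borel_measurable_norm)

lemma L2_on_scaled_bound:
  fixes f :: "real \<Rightarrow> 'a::euclidean_space" and g :: "real \<Rightarrow> 'b::euclidean_space"
  assumes "S \<in> sets lebesgue" and "f \<in> borel_measurable (lebesgue_on S)" and "L2_on S g" and "0 \<le> c"
    and "\<And>t. t \<in> S \<Longrightarrow> norm (f t) \<le> c * norm (g t)"
  shows "L2_on S f" and "L2_norm_on S f \<le> c * L2_norm_on S g"
  using L2_on_dominated[OF assms(1,2) L2_on_scale(1)[OF assms(1,3), of c]] 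
    L2_on_scale(2)[OF assms(1,3), of c] assms by auto

lemma L2_on_product_integrable:
  assumes S: "S \<in> sets lebesgue" and f: "L2_on S f" and g: "L2_on S g"
  shows "(\<lambda>t. norm (f t) * norm (g t)) integrable_on S"
proof -
  have i: "(\<lambda>t. (norm (f t))\<^sup>2 + (norm (g t))\<^sup>2) integrable_on S"
    using assms by (intro integrable_add) (auto simp: L2_on_iff)
  have "norm (norm (f t) * norm (g t)) \<le> (norm (f t))\<^sup>2 + (norm (g t))\<^sup>2" for t
    using sum_squares_bound[of "norm (f t)" "norm (g t)"] mult_nonneg_nonneg[of "norm (f t)" "norm (g t)"]
    unfolding real_norm_def abs_mult abs_norm_cancel by (simp del: zero_le_mult_iff mult_nonneg_nonneg)
  then have "(\<lambda>t. norm (f t) * norm (g t)) absolutely_integrable_on S"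
    by (intro measurable_bounded_by_integrable_imp_absolutely_integrable[OF _ S i])
      (use assms in \<open>auto simp: L2_on_iff intro!: borel_measurable_times borel_measurable_norm\<close>)
  then show ?thesis by (simp add: absolutely_integrable_on_def)
qed

text \<open>With \<open>\<epsilon> = b / a\<close> the weighted mean equals \<open>2 a b\<close>; if \<open>a\<close> or \<open>b\<close> vanishes, a very large or very
  small \<open>\<epsilon>\<close> shows that \<open>x\<close> cannot be positive. This is the passage from Young's inequality to
  the Cauchy-Schwarz inequality.\<close>

lemma le_product_if_le_weighted_means:
  fixes x a b :: real
  assumes "0 \<le> a" "0 \<le> b" and le: "\<And>\<epsilon>. \<epsilon> > 0 \<Longrightarrow> 2 * x \<le> \<epsilon> * a\<^sup>2 + b\<^sup>2 / \<epsilon>"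
  shows "x \<le> a * b"
proof -
  consider "a > 0" "b > 0" | "a = 0" | "b = 0" using assms by fastforce
  then show ?thesis
  proof cases
    case 1
    then show ?thesis using le[of "b / a"] by (simp add: field_simps power2_eq_square)
  next
    case 2
    show ?thesis
    proof (rule ccontr)
      assume "\<not> ?thesis"
      then have "x > 0" using 2 by simp
      then have "2 * x \<le> b\<^sup>2 * x / (b\<^sup>2 + 1)"
        using le[of "(b\<^sup>2 + 1) / x"] 2 by (simp add: add_nonneg_pos)
      also have "\<dots> \<le> x" using \<open>x > 0\<close> by (simp add: pos_divide_le_eq add_nonneg_pos add_pos_nonneg algebra_simps)
      finally show False using \<open>x > 0\<close> by simp
    qed
  next
    case 3
    show ?thesis
    proof (rule ccontr)
      assume "\<not> ?thesis"
      then have "x > 0" using 3 by simp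
      then have "2 * x \<le> x / (a\<^sup>2 + 1) * a\<^sup>2"
        using le[of "x / (a\<^sup>2 + 1)"] 3 by (simp add: add_nonneg_pos)
      also have "\<dots> \<le> x" using \<open>x > 0\<close> by (simp add: pos_divide_le_eq add_nonneg_pos add_pos_nonneg algebra_simps)
      finally show False using \<open>x > 0\<close> by simp
    qed
  qed
qed

lemma L2_Cauchy_Schwarz:
  assumes S: "S \<in> sets lebesgue" and f: "L2_on S f" and g: "L2_on S g"
  shows "integral S (\<lambda>t. norm (f t) * norm (g t)) \<le> L2_norm_on S f * L2_norm_on S g"
proof (rule le_product_if_le_weighted_means)
  fix \<epsilon> :: real assume "\<epsilon> > 0"
  have fi: "(\<lambda>t. \<epsilon> * (norm (f t))\<^sup>2) integrable_on S" and gi: "(\<lambda>t. (norm (g t))\<^sup>2 / \<epsilon>) integrable_on S"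
    using assms by (auto simp: L2_on_iff intro!: integrable_on_mult_right integrable_on_divide)
  have pt: "2 * (norm (f t) * norm (g t)) \<le> \<epsilon> * (norm (f t))\<^sup>2 + (norm (g t))\<^sup>2 / \<epsilon>" for t
  proof -
    have "0 \<le> (\<epsilon> * norm (f t) - norm (g t))\<^sup>2 / \<epsilon>" using \<open>\<epsilon> > 0\<close> by simp
    also have "\<dots> = \<epsilon> * (norm (f t))\<^sup>2 + (norm (g t))\<^sup>2 / \<epsilon> - 2 * (norm (f t) * norm (g t))"
      using \<open>\<epsilon> > 0\<close> by (simp add: field_simps power2_eq_square)
    finally show ?thesis by simp
  qed
  have "2 * integral S (\<lambda>t. norm (f t) * norm (g t)) = integral S (\<lambda>t. 2 * (norm (f t) * norm (g t)))"
    by simp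
  also have "\<dots> \<le> integral S (\<lambda>t. \<epsilon> * (norm (f t))\<^sup>2 + (norm (g t))\<^sup>2 / \<epsilon>)"
    using integrable_on_mult_right[OF L2_on_product_integrable[OF assms]] integrable_add[OF fi gi] pt
    by (rule integral_le)
  also have "\<dots> = \<epsilon> * (L2_norm_on S f)\<^sup>2 + (L2_norm_on S g)\<^sup>2 / \<epsilon>"
    using fi gi by (simp add: Henstock_Kurzweil_Integration.integral_add L2_norm_on_square f g)
  finally show "2 * integral S (\<lambda>t. norm (f t) * norm (g t)) \<le> \<epsilon> * (L2_norm_on S f)\<^sup>2 + (L2_norm_on S g)\<^sup>2 / \<epsilon>" .
qed auto

lemma L2_on_add:
  fixes f g :: "real \<Rightarrow> 'a::euclidean_space"
  assumes S: "S \<in> sets lebesgue" and f: "L2_on S f" and g: "L2_on S g"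
  shows "L2_on S (\<lambda>t. f t + g t)" and "L2_norm_on S (\<lambda>t. f t + g t) \<le> L2_norm_on S f + L2_norm_on S g"
proof -
  let ?h = "\<lambda>t. (norm (f t))\<^sup>2 + (norm (g t))\<^sup>2 + 2 * (norm (f t) * norm (g t))"
  have fi: "(\<lambda>t. (norm (f t))\<^sup>2) integrable_on S" and gi: "(\<lambda>t. (norm (g t))\<^sup>2) integrable_on S"
    using assms by (auto simp: L2_on_iff)
  note fg = L2_on_product_integrable[OF assms]
  have h: "?h integrable_on S"
    using fi gi fg by (intro integrable_add integrable_on_mult_right)
  have le: "(norm (f t + g t))\<^sup>2 \<le> ?h t" for t
  proof -
    have "(norm (f t + g t))\<^sup>2 \<le> (norm (f t) + norm (g t))\<^sup>2"
      by (intro power_mono norm_triangle_ineq) auto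
    then show ?thesis by (simp add: power2_sum)
  qed
  have m: "(\<lambda>t. f t + g t) \<in> borel_measurable (lebesgue_on S)"
    using assms by (auto simp: L2_on_iff intro!: borel_measurable_add)
  have "(\<lambda>t. (norm (f t + g t))\<^sup>2) absolutely_integrable_on S"
    by (rule measurable_bounded_by_integrable_imp_absolutely_integrable[OF _ S h])
      (use m le in \<open>auto intro!: borel_measurable_power borel_measurable_norm\<close>)
  then have i: "(\<lambda>t. (norm (f t + g t))\<^sup>2) integrable_on S" by (simp add: absolutely_integrable_on_def)
  then show L: "L2_on S (\<lambda>t. f t + g t)" using m S by (simp add: L2_on_iff)
  have "(L2_norm_on S (\<lambda>t. f t + g t))\<^sup>2 \<le> integral S ?h"
    unfolding L2_norm_on_square[OF L] using i h le by (intro integral_le) auto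
  also have "\<dots> = (L2_norm_on S f)\<^sup>2 + (L2_norm_on S g)\<^sup>2 + 2 * integral S (\<lambda>t. norm (f t) * norm (g t))"
    using fi gi fg
    by (simp add: Henstock_Kurzweil_Integration.integral_add integrable_add integrable_on_mult_right
        L2_norm_on_square f g)
  also have "\<dots> \<le> (L2_norm_on S f + L2_norm_on S g)\<^sup>2"
    using L2_Cauchy_Schwarz[OF assms] by (simp add: power2_sum)
  finally show "L2_norm_on S (\<lambda>t. f t + g t) \<le> L2_norm_on S f + L2_norm_on S g"
    by (rule power2_le_imp_le) simp
qed

lemma L2_on_Pair:
  assumes S: "S \<in> sets lebesgue"
  shows "L2_on S (\<lambda>t. (f t, g t)) \<longleftrightarrow> L2_on S f \<and> L2_on S g"
    and "L2_on S f \<Longrightarrow> L2_on S g \<Longrightarrow>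
      (L2_norm_on S (\<lambda>t. (f t, g t)))\<^sup>2 = (L2_norm_on S f)\<^sup>2 + (L2_norm_on S g)\<^sup>2"
proof -
  show iff: "L2_on S (\<lambda>t. (f t, g t)) \<longleftrightarrow> L2_on S f \<and> L2_on S g"
  proof
    assume L: "L2_on S (\<lambda>t. (f t, g t))"
    then have m: "(\<lambda>t. (f t, g t)) \<in> borel_measurable (lebesgue_on S)" using S by (simp add: L2_on_iff)
    have "(\<lambda>t. fst (f t, g t)) \<in> borel_measurable (lebesgue_on S)"
      by (rule measurable_compose[OF m borel_measurable_continuous_onI]) (intro continuous_intros)
    moreover have "(\<lambda>t. snd (f t, g t)) \<in> borel_measurable (lebesgue_on S)"
      by (rule measurable_compose[OF m borel_measurable_continuous_onI]) (intro continuous_intros)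
    ultimately show "L2_on S f \<and> L2_on S g"
      using L2_on_dominated(1)[OF S _ L, of f] L2_on_dominated(1)[OF S _ L, of g] by (auto simp: norm_Pair)
  next
    assume "L2_on S f \<and> L2_on S g"
    then show "L2_on S (\<lambda>t. (f t, g t))"
      using S by (auto simp: L2_on_iff norm_Pair intro!: borel_measurable_Pair integrable_add)
  qed
  assume f: "L2_on S f" and g: "L2_on S g"
  then have fg: "L2_on S (\<lambda>t. (f t, g t))" by (simp add: iff)
  show "(L2_norm_on S (\<lambda>t. (f t, g t)))\<^sup>2 = (L2_norm_on S f)\<^sup>2 + (L2_norm_on S g)\<^sup>2"
    using f g S unfolding L2_norm_on_square[OF f] L2_norm_on_square[OF g] L2_norm_on_square[OF fg]
    by (simp add: norm_Pair L2_on_iff Henstock_Kurzweil_Integration.integral_add)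
qed

lemma L2_on_imp_absolutely_integrable:
  fixes f :: "real \<Rightarrow> 'a::euclidean_space"
  assumes "L2_on {a..b} f"
  shows "f absolutely_integrable_on {a..b}"
proof (rule measurable_bounded_by_integrable_imp_absolutely_integrable)
  show "f \<in> borel_measurable (lebesgue_on {a..b})"  using assms by (simp add: L2_on_iff)
  show "(\<lambda>t. (norm (f t))\<^sup>2 + 1) integrable_on {a..b}"
    using assms by (intro integrable_add) (auto simp: L2_on_iff)
  show "norm (f t) \<le> (norm (f t))\<^sup>2 + 1" for t
    using sum_squares_bound[of "norm (f t)" 1] by (simp; smt (verit) norm_ge_zero)
qed simp

lemma L2_on_continuous:
  fixes f :: "real \<Rightarrow> 'a::euclidean_space"
  assumes "continuous_on {a..b} f"
  shows "L2_on {a..b} f"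
  using assms
  by (auto simp: L2_on_iff intro!: continuous_imp_measurable_on_sets_lebesgue integrable_continuous_real continuous_intros)

lemma L2_on_linear:
  fixes f :: "real \<Rightarrow> 'a::euclidean_space" and h :: "'a \<Rightarrow> 'b::euclidean_space"
  assumes S: "S \<in> sets lebesgue" and f: "L2_on S f" and h: "bounded_linear h"
    and c: "0 \<le> c" "\<And>x. norm (h x) \<le> c * norm x"
  shows "L2_on S (\<lambda>t. h (f t))" and "L2_norm_on S (\<lambda>t. h (f t)) \<le> c * L2_norm_on S f"
proof -
  have "f \<in> borel_measurable (lebesgue_on S)" using S f by (simp add: L2_on_iff)
  then have "(\<lambda>t. h (f t)) \<in> borel_measurable (lebesgue_on S)"
    by (rule measurable_compose[OF _ borel_measurable_continuous_onI])
       (use h linear_continuous_on in blast)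
  from L2_on_scaled_bound[OF S this f c(1) c(2)]
  show "L2_on S (\<lambda>t. h (f t))" "L2_norm_on S (\<lambda>t. h (f t)) \<le> c * L2_norm_on S f" .
qed

lemma L2_on_matrix:
  assumes "S \<in> sets lebesgue" and "L2_on S f"
  shows "L2_on S (\<lambda>t. A *v f t)" and "L2_norm_on S (\<lambda>t. A *v f t) \<le> spectral_norm A * L2_norm_on S f"
  using L2_on_linear[OF assms matrix_vector_mul_bounded_linear spectral_norm_nonneg norm_matrix_vector_le_spectral] .

lemma L2_norm_matrix_le:
  assumes "S \<in> sets lebesgue" "L2_on S f" "spectral_norm A \<le> L"
  shows "L2_norm_on S (\<lambda>t. A *v f t) \<le> L * L2_norm_on S f"
  using L2_on_matrix(2)[OF assms(1,2), of A] mult_right_mono[OF assms(3), of "L2_norm_on S f"] by simp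

lemma L2_reverse:
  fixes f :: "real \<Rightarrow> 'a::euclidean_space"
  assumes f: "L2_on {0..T} f"
  shows "L2_on {0..T} (\<lambda>t. f (T - t))" and "L2_norm_on {0..T} (\<lambda>t. f (T - t)) = L2_norm_on {0..T} f"
proof -
  have "f absolutely_integrable_on {0..T}" by (rule L2_on_imp_absolutely_integrable[OF f])
  from absolutely_integrable_reverse[OF this]
  have m: "(\<lambda>t. f (T - t)) \<in> borel_measurable (lebesgue_on {0..T})"
    by (simp add: absolutely_integrable_measurable)
  have "(\<lambda>t. (norm (f t))\<^sup>2) integrable_on {0..T}" using f by (simp add: L2_on_iff)
  from has_integral_reverse[OF integrable_integral[OF this], of T]
  have i: "((\<lambda>t. (norm (f (T - t)))\<^sup>2) has_integral integral {0..T} (\<lambda>t. (norm (f t))\<^sup>2)) {0..T}" by simp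
  then show L: "L2_on {0..T} (\<lambda>t. f (T - t))" using m by (auto simp: L2_on_iff)
  show "L2_norm_on {0..T} (\<lambda>t. f (T - t)) = L2_norm_on {0..T} f"
    using i by (simp add: L2_norm_on_eq L f integral_unique)
qed

section \<open>Stable systems\<close>

lemma stable_bound:
  "stable L \<alpha> \<Phi> \<Longrightarrow> 0 \<le> t \<Longrightarrow> norm (matrix_exp (t *\<^sub>R \<Phi>) *v x) \<le> L * exp (- \<alpha> * t) * norm x"
  unfolding stable_def by (meson mult_right_mono norm_ge_zero norm_matrix_vector_le_spectral order_trans)

lemma stable_transpose:
  assumes "stable L \<alpha> \<Phi>"
  shows "stable L \<alpha> (transpose \<Phi>)"
proof -
  have "t *\<^sub>R transpose \<Phi> = transpose (t *\<^sub>R \<Phi>)" for t by (simp add: transpose_scalar)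
  then show ?thesis
    using assms unfolding stable_def 
    by (auto simp: transpose_matrix_exp intro: order_trans[OF spectral_norm_transpose_le])
qed

text \<open>The squared norm of a trajectory loses at most the rate \<open>2 \<parallel>\<Phi>\<parallel>\<close>, so its product with
  \<open>exp (2 \<parallel>\<Phi>\<parallel> t)\<close> is nondecreasing.\<close>

lemma norm_matrix_exp_lower_bound:
  fixes \<Phi> :: "real^'n^'n"
  assumes "0 \<le> t"
  shows "exp (- spectral_norm \<Phi> * t) * norm x \<le> norm (matrix_exp (t *\<^sub>R \<Phi>) *v x)"
proof -
  define M where "M = spectral_norm \<Phi>"
  define y where "y t = matrix_exp (t *\<^sub>R \<Phi>) *v x" for t
  define g where "g t = exp (2 * M * t) * (y t \<bullet> y t)" for t
  have y: "(y has_vector_derivative \<Phi> *v y t) (at t)" for t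
    using bounded_linear.has_vector_derivative[OF mv.bounded_linear_left[of x] matrix_exp_has_vector_derivative[of \<Phi> t]]
    by (simp add: y_def[abs_def] matrix_vector_mul_assoc)
  have yy: "((\<lambda>t. y t \<bullet> y t) has_real_derivative 2 * (y t \<bullet> (\<Phi> *v y t))) (at t)" for t
    using bounded_bilinear.has_vector_derivative[OF bounded_bilinear_inner y y, of t]
    by (simp add: has_real_derivative_iff_has_vector_derivative inner_commute)
  have g: "(g has_real_derivative exp (2 * M * t) * (2 * M * (y t \<bullet> y t) + 2 * (y t \<bullet> (\<Phi> *v y t)))) (at t)" for t
    unfolding g_def by (auto intro!: derivative_eq_intros yy simp: algebra_simps)
  have "0 \<le> 2 * M * (y t \<bullet> y t) + 2 * (y t \<bullet> (\<Phi> *v y t))" for t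
  proof -
    have "\<bar>y t \<bullet> (\<Phi> *v y t)\<bar> \<le> norm (y t) * norm (\<Phi> *v y t)" by (rule Cauchy_Schwarz_ineq2)
    also have "\<dots> \<le> norm (y t) * (M * norm (y t))"
      unfolding M_def by (intro mult_left_mono norm_matrix_vector_le_spectral) auto
    finally show ?thesis by (simp add: power2_norm_eq_inner[symmetric] power2_eq_square algebra_simps)
  qed
  then have "g 0 \<le> g t"
    using g assms by (intro DERIV_nonneg_imp_nondecreasing[of 0 t g]) (auto intro!: exI mult_nonneg_nonneg)
  then have "(norm x)\<^sup>2 \<le> (exp (M * t) * norm (y t))\<^sup>2"
    by (simp add: g_def y_def power_mult_distrib power2_norm_eq_inner exp_double[symmetric] mult.assoc)
  then have "norm x \<le> exp (M * t) * norm (y t)"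
    by (rule power2_le_imp_le) simp
  then show ?thesis by (simp add: M_def y_def exp_minus field_simps)
qed

text \<open>A trajectory cannot decay faster than \<open>exp (- \<parallel>\<Phi>\<parallel> t)\<close>; a larger rate \<open>\<alpha>\<close> would contradict the
  stability bound for large \<open>t\<close>.\<close>

lemma stable_rate_le_spectral_norm:
  fixes \<Phi> :: "real^'n^'n"
  assumes "stable L \<alpha> \<Phi>"
  shows "\<alpha> \<le> spectral_norm \<Phi>"
proof (rule ccontr)
  let ?M = "spectral_norm \<Phi>"
  assume "\<not> \<alpha> \<le> ?M"
  then have pos: "\<alpha> - ?M > 0" by simp
  obtain x :: "real^'n" where x: "norm x = 1" using vector_choose_size[of 1] by auto
  define t where "t = (\<bar>L\<bar> + 1) / (\<alpha> - ?M)"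
  have t: "0 \<le> t" using pos by (simp add: t_def)
  have "exp (- ?M * t) \<le> L * exp (- \<alpha> * t)"
    using norm_matrix_exp_lower_bound[OF t, of \<Phi> x] stable_bound[OF assms t, of x] x by simp
  then have "exp ((\<alpha> - ?M) * t) \<le> L"
    by (simp add: exp_minus exp_diff field_simps)
  moreover have "1 + (\<alpha> - ?M) * t \<le> exp ((\<alpha> - ?M) * t)" by (rule exp_ge_add_one_self)
  moreover have "(\<alpha> - ?M) * t = \<bar>L\<bar> + 1" using pos by (simp add: t_def)
  ultimately show False by linarith
qed

text \<open>If \<open>y\<close> exceeded \<open>g + w\<close>, then \<open>y (y - g)\<close> would exceed \<open>w\<^sup>2\<close>.\<close>

lemma quadratic_bound:
  fixes y g w :: real
  assumes "y\<^sup>2 \<le> g * y + w\<^sup>2" "0 \<le> g" "0 \<le> w"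
  shows "y \<le> g + w"
proof (rule ccontr)
  assume "\<not> y \<le> g + w"
  then have "w * w < y * (y - g)" using assms
    by (intro mult_strict_mono') auto
  then show False using assms(1) by (simp add: power2_eq_square algebra_simps)
qed

text \<open>Integrating the derivative of \<open>v\<^sup>2\<close> and applying the Cauchy-Schwarz inequality gives
  \<open>v(T)\<^sup>2 + 2 \<alpha> \<parallel>v\<parallel>\<^sup>2 \<le> v(0)\<^sup>2 + 2 L \<parallel>\<eta>\<parallel> \<parallel>v\<parallel>\<close>. This one inequality contains the \<open>L\<^sup>1\<close>-\<open>L\<^sup>2\<close>
  convolution bound with the kernel \<open>L exp (- \<alpha> t)\<close> and the bound of the end value.\<close>

lemma comparison_function_bounds:
  fixes v \<eta> :: "real \<Rightarrow> real"
  assumes "\<alpha> > 0" and "0 \<le> L" and "0 \<le> T"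
    and v: "primitive_on T v (\<lambda>t. - \<alpha> * v t + L * \<eta> t)"
    and nonneg: "\<And>t. t \<in> {0..T} \<Longrightarrow> 0 \<le> v t" "\<And>t. t \<in> {0..T} \<Longrightarrow> 0 \<le> \<eta> t"
    and \<eta>: "L2_on {0..T} \<eta>"
  shows "L2_norm_on {0..T} v \<le> L / \<alpha> * L2_norm_on {0..T} \<eta> + v 0 / sqrt (2 * \<alpha>)"
    and "v T \<le> v 0 + L / sqrt (2 * \<alpha>) * L2_norm_on {0..T} \<eta>"
proof -
  let ?y = "L2_norm_on {0..T} v" and ?H = "L2_norm_on {0..T} \<eta>"
  have v0: "0 \<le> v 0" using nonneg(1)[of 0] \<open>0 \<le> T\<close> by simp
  have vL: "L2_on {0..T} v" using primitive_on_continuous[OF v] by (rule L2_on_continuous)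
  have S: "{0..T} \<in> sets lebesgue" by simp
  have "primitive_on T (\<lambda>t. v t * v t) (\<lambda>t. (- \<alpha> * v t + L * \<eta> t) * v t + v t * (- \<alpha> * v t + L * \<eta> t))"
    by (rule primitive_on_product[OF bounded_bilinear_mult v v])
  from primitive_on_increment[OF this, of 0 T] assms(3)
  have I: "((\<lambda>t. (- \<alpha> * v t + L * \<eta> t) * v t + v t * (- \<alpha> * v t + L * \<eta> t)) has_integral v T * v T - v 0 * v 0) {0..T}"
    by simp
  have "((\<lambda>t. (v t)\<^sup>2) has_integral ?y\<^sup>2) {0..T}"
    using vL L2_norm_on_square[OF vL] by (simp add: L2_on_iff has_integral_integral)
  moreover have J: "((\<lambda>t. norm (v t) * norm (\<eta> t)) has_integral integral {0..T} (\<lambda>t. norm (v t) * norm (\<eta> t))) {0..T}"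
    using L2_on_product_integrable[OF S vL \<eta>] by (rule integrable_integral)
  ultimately have "((\<lambda>t. - 2 * \<alpha> * (v t)\<^sup>2 + 2 * L * (norm (v t) * norm (\<eta> t))) has_integral
      - 2 * \<alpha> * ?y\<^sup>2 + 2 * L * integral {0..T} (\<lambda>t. norm (v t) * norm (\<eta> t))) {0..T}"
    by (intro has_integral_add has_integral_mult_right)
  then have "((\<lambda>t. (- \<alpha> * v t + L * \<eta> t) * v t + v t * (- \<alpha> * v t + L * \<eta> t)) has_integral
      - 2 * \<alpha> * ?y\<^sup>2 + 2 * L * integral {0..T} (\<lambda>t. norm (v t) * norm (\<eta> t))) {0..T}"
    by (rule has_integral_eq[rotated]) (use nonneg in \<open>simp add: algebra_simps power2_eq_square\<close>)
  with I have "v T * v T - v 0 * v 0 = - 2 * \<alpha> * ?y\<^sup>2 + 2 * L * integral {0..T} (\<lambda>t. norm (v t) * norm (\<eta> t))"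
    by (rule has_integral_unique)
  moreover have "L * integral {0..T} (\<lambda>t. norm (v t) * norm (\<eta> t)) \<le> L * (?y * ?H)"
    using L2_Cauchy_Schwarz[OF S vL \<eta>] \<open>0 \<le> L\<close> by (rule mult_left_mono)
  ultimately have energy: "(v T)\<^sup>2 + 2 * \<alpha> * ?y\<^sup>2 \<le> (v 0)\<^sup>2 + 2 * L * ?H * ?y"
    by (simp add: power2_eq_square algebra_simps)
  have "2 * \<alpha> * ?y\<^sup>2 \<le> (v 0)\<^sup>2 + 2 * L * ?H * ?y"
    using energy zero_le_power2[of "v T"] by linarith
  then have "?y\<^sup>2 \<le> ((v 0)\<^sup>2 + 2 * L * ?H * ?y) / (2 * \<alpha>)"
    using \<open>\<alpha> > 0\<close> by (subst pos_le_divide_eq) (simp_all add: mult.commute)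
  also have "\<dots> = L / \<alpha> * ?H * ?y + (v 0 / sqrt (2 * \<alpha>))\<^sup>2"
    using \<open>\<alpha> > 0\<close> by (simp add: power_divide add_divide_distrib)
  finally have "?y\<^sup>2 \<le> L / \<alpha> * ?H * ?y + (v 0 / sqrt (2 * \<alpha>))\<^sup>2" .
  then show "?y \<le> L / \<alpha> * ?H + v 0 / sqrt (2 * \<alpha>)"
  proof (rule quadratic_bound)
    show "0 \<le> L / \<alpha> * ?H" "0 \<le> v 0 / sqrt (2 * \<alpha>)"
      using \<open>\<alpha> > 0\<close> \<open>0 \<le> L\<close> v0 by simp_all
  qed
  \<comment> \<open>Maximize \<open>2 L H y - 2 \<alpha> y\<^sup>2\<close> over \<open>y\<close> by completing the square.\<close>
  have "0 \<le> (2 * \<alpha> * ?y - L * ?H)\<^sup>2 / (2 * \<alpha>)" using \<open>\<alpha> > 0\<close> by simp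
  also have "\<dots> = 2 * \<alpha> * ?y\<^sup>2 - 2 * L * ?H * ?y + (L / sqrt (2 * \<alpha>) * ?H)\<^sup>2"
    using \<open>\<alpha> > 0\<close> by (simp add: power2_diff power_mult_distrib power_divide) (simp add: power2_eq_square field_simps)
  finally have "(v T)\<^sup>2 \<le> (v 0)\<^sup>2 + (L / sqrt (2 * \<alpha>) * ?H)\<^sup>2"
    using energy by linarith
  also have "\<dots> \<le> (v 0 + L / sqrt (2 * \<alpha>) * ?H)\<^sup>2"
    using \<open>\<alpha> > 0\<close> \<open>0 \<le> L\<close> v0 by (simp add: power2_sum)
  finally show "v T \<le> v 0 + L / sqrt (2 * \<alpha>) * ?H"
    by (rule power2_le_imp_le) (use \<open>\<alpha> > 0\<close> \<open>0 \<le> L\<close> v0 in simp)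
qed

text \<open>Variation of constants and the stability bound show that \<open>|f|\<close> is dominated by the solution \<open>v\<close> of the
  scalar equation \<open>v' = - \<alpha> v + L |h|\<close>, \<open>v(0) = L |f(0)|\<close>, whose size is known from the energy
  inequality.\<close>

lemma stable_decay:
  fixes \<Phi> :: "real^'n^'n"
  assumes \<Phi>: "stable L \<alpha> \<Phi>" and "\<alpha> > 0" and "0 \<le> L" and T: "0 \<le> T"
    and f: "primitive_on T f (\<lambda>t. \<Phi> *v f t + h t)" and h: "L2_on {0..T} h"
  shows "L2_norm_on {0..T} f \<le> L / \<alpha> * L2_norm_on {0..T} h + L / sqrt (2 * \<alpha>) * norm (f 0)"
    and "norm (f T) \<le> L * norm (f 0) + L / sqrt (2 * \<alpha>) * L2_norm_on {0..T} h"
proof -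
  define k where "k \<tau> = exp (\<alpha> * \<tau>) * (L * norm (h \<tau>))" for \<tau>
  define w where "w t = L * norm (f 0) + integral {0..t} k" for t
  define v where "v t = exp (- \<alpha> * t) * w t" for t
  have S: "{0..T} \<in> sets lebesgue" by simp
  have hn: "L2_on {0..T} (\<lambda>t. norm (h t))" "L2_norm_on {0..T} (\<lambda>t. norm (h t)) = L2_norm_on {0..T} h"
    using L2_on_norm[OF S h] by auto
  have Lh: "(\<lambda>t. L * norm (h t)) absolutely_integrable_on {0..T}"
    using L2_on_imp_absolutely_integrable[OF L2_on_scale(1)[OF S hn(1), of L]] by simp
  have "k absolutely_integrable_on {0..T}"
    unfolding k_def by (rule absolutely_integrable_bounded_bilinear[OF bounded_bilinear_mult _ Lh]) (intro continuous_intros)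
  then have w: "primitive_on T w k" by (simp add: primitive_on_def w_def)
  have e: "primitive_on T (\<lambda>t. exp (- \<alpha> * t)) (\<lambda>t. - \<alpha> * exp (- \<alpha> * t))"
    by (rule primitive_on_C1)
      (auto intro!: continuous_intros derivative_eq_intros simp flip: has_real_derivative_iff_has_vector_derivative)
  have v: "primitive_on T v (\<lambda>t. - \<alpha> * v t + L * norm (h t))"
    by (rule primitive_on_cong[OF primitive_on_product[OF bounded_bilinear_mult e w]])
      (auto simp: v_def k_def exp_minus field_simps)
  have fv: "norm (f t) \<le> v t" if t: "t \<in> {0..T}" for t
  proof -
    note mild = primitive_imp_mild[OF f t]
    have k: "k integrable_on {0..t}" using primitive_on_integrable[OF w] t by auto
    have "norm (f t - matrix_exp (t *\<^sub>R \<Phi>) *v f 0) \<le> exp (- \<alpha> * t) * integral {0..t} k"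
      unfolding integral_unique[OF mild, symmetric] integral_mult_right[symmetric]
    proof (rule integral_norm_bound_integral)
      show "norm (matrix_exp ((t - \<tau>) *\<^sub>R \<Phi>) *v h \<tau>) \<le> exp (- \<alpha> * t) * k \<tau>" if "\<tau> \<in> {0..t}" for \<tau>
        using stable_bound[OF \<Phi>, of "t - \<tau>" "h \<tau>"] that
        by (simp add: k_def algebra_simps exp_diff exp_minus exp_add field_simps)
      show "(\<lambda>\<tau>. exp (- \<alpha> * t) * k \<tau>) integrable_on {0..t}"
        using k by (rule integrable_on_mult_right)
    qed (use mild in blast)
    moreover have "norm (matrix_exp (t *\<^sub>R \<Phi>) *v f 0) \<le> L * exp (- \<alpha> * t) * norm (f 0)"
      using stable_bound[OF \<Phi>] t by simp
    moreover have "norm (f t) \<le> norm (f t - matrix_exp (t *\<^sub>R \<Phi>) *v f 0) + norm (matrix_exp (t *\<^sub>R \<Phi>) *v f 0)"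
      by (metis diff_add_cancel norm_triangle_ineq)
    ultimately show ?thesis by (simp add: v_def w_def algebra_simps)
  qed
  have vpos: "0 \<le> v t" if "t \<in> {0..T}" for t
    using fv[OF that] by (meson norm_ge_zero order_trans)
  have v0: "v 0 = L * norm (f 0)" by (simp add: v_def w_def)
  have vL: "L2_on {0..T} v" using primitive_on_continuous[OF v] by (rule L2_on_continuous)
  note en = comparison_function_bounds[OF \<open>\<alpha> > 0\<close> \<open>0 \<le> L\<close> T v vpos norm_ge_zero hn(1), unfolded hn(2) v0]
  have "L2_norm_on {0..T} f \<le> L2_norm_on {0..T} v"
    using primitive_on_continuous[OF f] fv vpos
    by (intro L2_on_dominated(2)[OF S _ vL] continuous_imp_measurable_on_sets_lebesgue) auto
  with en(1) show "L2_norm_on {0..T} f \<le> L / \<alpha> * L2_norm_on {0..T} h + L / sqrt (2 * \<alpha>) * norm (f 0)"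
    using T by (auto simp: field_simps)
  show "norm (f T) \<le> L * norm (f 0) + L / sqrt (2 * \<alpha>) * L2_norm_on {0..T} h"
    using order_trans[OF fv en(2)] T by auto
qed

lemma stable_decay_backward:
  fixes \<Phi> :: "real^'n^'n"
  assumes \<Phi>: "stable L \<alpha> \<Phi>" and "\<alpha> > 0" and "0 \<le> L" and T: "0 \<le> T"
    and f: "primitive_on T f (\<lambda>t. - (\<Phi> *v f t + h t))" and h: "L2_on {0..T} h"
  shows "L2_norm_on {0..T} f \<le> L / \<alpha> * L2_norm_on {0..T} h + L / sqrt (2 * \<alpha>) * norm (f T)"
    and "norm (f 0) \<le> L * norm (f T) + L / sqrt (2 * \<alpha>) * L2_norm_on {0..T} h"
proof -
  have r: "primitive_on T (\<lambda>t. f (T - t)) (\<lambda>t. \<Phi> *v f (T - t) + h (T - t))"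
    using primitive_on_reverse[OF f] by (simp add: add.commute)
  have fL: "L2_on {0..T} f" using primitive_on_continuous[OF f] by (rule L2_on_continuous)
  note d = stable_decay[OF assms(1-4) r L2_reverse(1)[OF h]]
  show "L2_norm_on {0..T} f \<le> L / \<alpha> * L2_norm_on {0..T} h + L / sqrt (2 * \<alpha>) * norm (f T)"
    using d(1) by (simp add: L2_reverse(2)[OF h] L2_reverse(2)[OF fL])
  show "norm (f 0) \<le> L * norm (f T) + L / sqrt (2 * \<alpha>) * L2_norm_on {0..T} h"
    using d(2) by (simp add: L2_reverse(2)[OF h])
qed

section \<open>Scalar inequalities and the decay constant\<close>

text \<open>How an energy that is bounded by \<open>P Z\<close> closes the estimate of \<open>Z\<close>: the first inequality gives
  \<open>E \<le> m S + \<nu> S + sqrt (P (k S + Z))\<close>, and by the inequality of arithmetic and geometric means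
  \<open>a sqrt (P (k S + Z))\<close> costs half of \<open>Z\<close> and otherwise only terms in \<open>P\<close> and \<open>S\<close>.\<close>

lemma absorb_quadratic:
  fixes E Z P S a b \<beta> m \<nu> k :: real
  assumes E: "E\<^sup>2 \<le> m * S * E + (\<nu> * S)\<^sup>2 + k * P * S + P * Z"
    and Z: "Z \<le> a * E + b * P + \<beta> * S"
    and pos: "0 \<le> m" "0 \<le> S" "0 \<le> \<nu>" "0 \<le> k" "0 \<le> P" "0 \<le> Z" "0 \<le> a"
  shows "Z \<le> (a\<^sup>2 + 2 * b) * P + (2 * \<beta> + 2 * a * m + 2 * a * \<nu> + k) * S"
proof -
  define R where "R = P * (k * S + Z)"
  have R: "0 \<le> R" using pos by (simp add: R_def)
  have "E\<^sup>2 \<le> (m * S) * E + (\<nu> * S + sqrt R)\<^sup>2"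
  proof -
    have "0 \<le> 2 * (\<nu> * S) * sqrt R" using pos R by simp
    then have "(\<nu> * S)\<^sup>2 + R \<le> (\<nu> * S + sqrt R)\<^sup>2" using R by (simp add: power2_sum)
    then show ?thesis using E by (simp add: R_def algebra_simps)
  qed
  then have "E \<le> m * S + (\<nu> * S + sqrt R)"
    by (rule quadratic_bound) (use pos R in simp_all)
  then have "a * E \<le> a * (m * S + (\<nu> * S + sqrt R))" using pos by (intro mult_left_mono)
  moreover have "2 * (a * sqrt R) \<le> a\<^sup>2 * P + (k * S + Z)"
    using sum_squares_bound[of "a * sqrt P" "sqrt (k * S + Z)"] pos
    by (simp add: R_def real_sqrt_mult power_mult_distrib)
  ultimately show ?thesis using Z by (simp add: algebra_simps)
qed

text \<open>A bound without roots and maxima, which keeps one branch of each and suffices for all comparisons with the constant.\<close>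

lemma decay_const_lower_bound:
  fixes L \<alpha> :: real
  assumes "1 \<le> L" "0 < \<alpha>"
  shows "(L / \<alpha>)\<^sup>2 * ((1 + 2 * L)\<^sup>2 + L * (1 + 2 * L) * (1 + L)) \<le> decay_const L \<alpha>"
proof -
  have "L\<^sup>2 * (1 + L) \<le> sqrt (\<alpha>\<^sup>2 + L ^ 4 * (1 + L)\<^sup>2)"
    using assms by (intro real_le_rsqrt) (simp add: power_mult_distrib)
  then have "L * (1 + 2 * L) * (L\<^sup>2 * (1 + L)) / \<alpha>\<^sup>2 \<le> L * (1 + 2 * L) * sqrt (\<alpha>\<^sup>2 + L ^ 4 * (1 + L)\<^sup>2) / \<alpha>\<^sup>2"
    using assms by (intro divide_right_mono mult_left_mono) auto
  moreover have "L\<^sup>2 * (1 + 2 * L)\<^sup>2 / \<alpha>\<^sup>2 * 1 \<le> L\<^sup>2 * (1 + 2 * L)\<^sup>2 / \<alpha>\<^sup>2 * max 1 (L\<^sup>2 * (1 + L)\<^sup>2 / (1 + 2 * L)\<^sup>2)"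
    using assms by (intro mult_left_mono) auto
  moreover have "(L / \<alpha>)\<^sup>2 * ((1 + 2 * L)\<^sup>2 + L * (1 + 2 * L) * (1 + L)) =
     L\<^sup>2 * (1 + 2 * L)\<^sup>2 / \<alpha>\<^sup>2 * 1 + L * (1 + 2 * L) * (L\<^sup>2 * (1 + L)) / \<alpha>\<^sup>2"
    using assms by (simp add: field_simps power2_eq_square)
  ultimately show ?thesis unfolding decay_const_def by linarith
qed

lemma decay_const_pos:
  assumes "1 \<le> L" "0 < \<alpha>"
  shows "0 < decay_const L \<alpha>"
proof -
  have "0 < (L / \<alpha>)\<^sup>2 * ((1 + 2 * L)\<^sup>2 + L * (1 + 2 * L) * (1 + L))"
    using assms by (intro mult_pos_pos add_pos_pos) auto
  then show ?thesis using decay_const_lower_bound[OF assms] by simp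
qed

text \<open>These are the two coefficients that \<open>absorb_quadratic\<close> produces in \<open>saddle_point_bound\<close>. Since
  \<open>g (1 + L) \<ge> 1\<close>, terms linear in \<open>g\<close> can be raised to terms quadratic in \<open>g\<close>; what remains are
  inequalities between polynomials in \<open>L \<ge> 1\<close>.\<close>

lemma gain_le_decay_const:
  fixes L \<alpha> :: real
  defines "g \<equiv> L / \<alpha>" and "D \<equiv> decay_const L \<alpha>"
  defines "\<beta> \<equiv> 3 / 4 * g * (1 + L)"
  assumes L: "1 \<le> L" and \<alpha>: "0 < \<alpha>" and g: "1 \<le> g * (1 + L)"
  shows "(g * (1 + 9 / 4 * L))\<^sup>2 + 2 * (g * (1 + L)) \<le> 2 * D"
    and "2 * \<beta> + 2 * (g * (1 + 9 / 4 * L)) * (3 / 2 * \<beta> * L) + 2 * (g * (1 + 9 / 4 * L)) * (3 / 8 * (1 + L))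
      + \<beta> * (1 + L) \<le> 4 * D"
proof -
  have gpos: "0 < g" using L \<alpha> by (simp add: g_def)
  have D: "g\<^sup>2 * ((1 + 2 * L)\<^sup>2 + L * (1 + 2 * L) * (1 + L)) \<le> D"
    unfolding g_def D_def by (rule decay_const_lower_bound[OF L \<alpha>])
  have up: "c * g \<le> g\<^sup>2 * (c * (1 + L))" if "0 \<le> c" for c
  proof -
    have "c * g * 1 \<le> c * g * (g * (1 + L))"
      using that gpos g by (intro mult_left_mono) auto
    then show ?thesis by (simp add: power2_eq_square ac_simps)
  qed
  have "(g * (1 + 9 / 4 * L))\<^sup>2 + 2 * (g * (1 + L)) \<le> g\<^sup>2 * ((1 + 9 / 4 * L)\<^sup>2 + 2 * (1 + L) * (1 + L))"
    unfolding power_mult_distrib distrib_left[of "g\<^sup>2"]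
    using up[of "2 * (1 + L)"] L by (intro add_mono order_refl) (simp add: ac_simps)
  also have "\<dots> \<le> g\<^sup>2 * (2 * ((1 + 2 * L)\<^sup>2 + L * (1 + 2 * L) * (1 + L)))"
  proof (rule mult_left_mono)
    have "2 * ((1 + 2 * L)\<^sup>2 + L * (1 + 2 * L) * (1 + L)) - ((1 + 9 / 4 * L)\<^sup>2 + 2 * (1 + L) * (1 + L))
        = 4 * L * (L * L) + 111 / 16 * (L * L) + (3 / 2 * L - 1)"
      by (simp add: power2_eq_square algebra_simps)
    also have "0 \<le> \<dots>" using L by (intro add_nonneg_nonneg) auto
    finally show "(1 + 9 / 4 * L)\<^sup>2 + 2 * (1 + L) * (1 + L) \<le> 2 * ((1 + 2 * L)\<^sup>2 + L * (1 + 2 * L) * (1 + L))"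
      by simp
  qed simp
  finally show "(g * (1 + 9 / 4 * L))\<^sup>2 + 2 * (g * (1 + L)) \<le> 2 * D"
    using D by linarith
  have "2 * \<beta> \<le> g\<^sup>2 * (3 / 2 * (1 + L) * (1 + L))"
  proof -
    have "2 * \<beta> = 3 / 2 * (1 + L) * g" by (simp add: \<beta>_def)
    then show ?thesis using up[of "3 / 2 * (1 + L)"] L by simp
  qed
  moreover have "2 * (g * (1 + 9 / 4 * L)) * (3 / 8 * (1 + L)) \<le> g\<^sup>2 * (3 / 4 * (1 + 9 / 4 * L) * (1 + L) * (1 + L))"
  proof -
    have "2 * (g * (1 + 9 / 4 * L)) * (3 / 8 * (1 + L)) = 3 / 4 * (1 + 9 / 4 * L) * (1 + L) * g"
      by (simp add: algebra_simps)
    also have "\<dots> \<le> g\<^sup>2 * (3 / 4 * (1 + 9 / 4 * L) * (1 + L) * (1 + L))"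
      by (rule up) (use L in simp)
    finally show ?thesis .
  qed
  moreover have "\<beta> * (1 + L) \<le> g\<^sup>2 * (3 / 4 * (1 + L) * (1 + L) * (1 + L))"
    using up[of "3 / 4 * (1 + L) * (1 + L)"] L by (simp add: \<beta>_def ac_simps)
  moreover have "2 * (g * (1 + 9 / 4 * L)) * (3 / 2 * \<beta> * L) = g\<^sup>2 * (9 / 4 * (1 + 9 / 4 * L) * (1 + L) * L)"
    by (simp add: \<beta>_def power2_eq_square)
  moreover have "g\<^sup>2 * (3 / 2 * (1 + L) * (1 + L)) + g\<^sup>2 * (9 / 4 * (1 + 9 / 4 * L) * (1 + L) * L)
      + g\<^sup>2 * (3 / 4 * (1 + 9 / 4 * L) * (1 + L) * (1 + L)) + g\<^sup>2 * (3 / 4 * (1 + L) * (1 + L) * (1 + L))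
      \<le> g\<^sup>2 * (4 * ((1 + 2 * L)\<^sup>2 + L * (1 + 2 * L) * (1 + L)))"
    unfolding distrib_left[symmetric]
  proof (rule mult_left_mono)
    have "4 * ((1 + 2 * L)\<^sup>2 + L * (1 + 2 * L) * (1 + L))
        - (3 / 2 * (1 + L) * (1 + L) + 9 / 4 * (1 + 9 / 4 * L) * (1 + L) * L
          + 3 / 4 * (1 + 9 / 4 * L) * (1 + L) * (1 + L) + 3 / 4 * (1 + L) * (1 + L) * (1 + L))
        = 1 / 2 * (L * L * L) + 205 / 16 * (L * L) + 149 / 16 * L + 1"
      by (simp add: power2_eq_square field_simps)
    also have "0 \<le> \<dots>" using L by simp
    finally show "3 / 2 * (1 + L) * (1 + L) + 9 / 4 * (1 + 9 / 4 * L) * (1 + L) * L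
      + 3 / 4 * (1 + 9 / 4 * L) * (1 + L) * (1 + L) + 3 / 4 * (1 + L) * (1 + L) * (1 + L)
      \<le> 4 * ((1 + 2 * L)\<^sup>2 + L * (1 + 2 * L) * (1 + L))"
      by simp
  qed simp
  ultimately show "2 * \<beta> + 2 * (g * (1 + 9 / 4 * L)) * (3 / 2 * \<beta> * L) + 2 * (g * (1 + 9 / 4 * L)) * (3 / 8 * (1 + L))
      + \<beta> * (1 + L) \<le> 4 * D"
    using D by linarith
qed

lemma norm_triple_mono:
  fixes a b c a' b' c' :: real
  assumes "\<bar>a\<bar> \<le> a'" "\<bar>b\<bar> \<le> b'" "\<bar>c\<bar> \<le> c'"
  shows "norm (a, b, c) \<le> norm (a', b', c')"
proof -
  have "a\<^sup>2 \<le> a'\<^sup>2" "b\<^sup>2 \<le> b'\<^sup>2" "c\<^sup>2 \<le> c'\<^sup>2"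
    using assms by (auto intro: power2_le_iff_abs_le[THEN iffD2])
  then show ?thesis by (simp add: norm_Pair)
qed

text \<open>The estimate of the whole solution reduced to real numbers: \<open>x, y, ns, nl\<close> are the norms of
  \<open>C s\<close>, \<open>u\<close>, \<open>s\<close>, \<open>l\<close>, while \<open>q, r, d\<close> are those of the data, \<open>\<sigma>, \<xi>\<close> those of the prescribed boundary values
  \<open>s(0)\<close>, \<open>l(T)\<close>, and \<open>sT\<close>, \<open>l0\<close> those of the free ones. The hypotheses on \<open>ns\<close>, \<open>nl\<close>, \<open>sT\<close>, \<open>l0\<close> are the decay
  estimates for the two stable equations, and the last one is the energy inequality.
  The factors \<open>9/4\<close>, \<open>3/2\<close>, \<open>3/4\<close>, \<open>3/8\<close> here and in \<open>gain_le_decay_const\<close> are rational upper bounds of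
  \<open>sqrt 5\<close>, \<open>sqrt 2\<close>, \<open>1 / sqrt 2\<close>, \<open>1 / sqrt 8\<close>.\<close>

lemma saddle_point_bound:
  fixes x y ns nl q r d \<sigma> \<xi> sT l0 L \<alpha> :: real
  defines "Z \<equiv> norm (ns, y, nl)" and "P \<equiv> norm (q, r, d)"
  defines "g \<equiv> L / \<alpha>" 
  defines "\<beta> \<equiv> 3 / 4 * g * (1 + L)"
  assumes pos: "0 \<le> x" "0 \<le> y" "0 \<le> ns" "0 \<le> nl" "0 \<le> q" "0 \<le> r" "0 \<le> d" "0 \<le> \<sigma>" "0 \<le> \<xi>"
    and L: "1 \<le> L" and \<alpha>: "0 < \<alpha>" and g: "1 \<le> g * (1 + L)"
    and ns: "ns \<le> g * (L * x + L * y + d) + \<beta> * \<sigma>"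
    and nl: "nl \<le> g * (L * y + L * r + q + L * x) + \<beta> * \<xi>"
    and sT: "sT \<le> L * \<sigma> + \<beta> * (L * x + L * y + d)"
    and l0: "l0 \<le> L * \<xi> + \<beta> * (L * y + L * r + q + L * x)"
    and energy: "x\<^sup>2 + y\<^sup>2 \<le> \<xi> * sT + \<sigma> * l0 + P * Z"
  shows "Z \<le> 2 * decay_const L \<alpha> * P + 4 * decay_const L \<alpha> * (\<sigma> + \<xi>)"
proof -
  define E where "E = sqrt (x\<^sup>2 + y\<^sup>2)"
  have gpos: "0 < g" using L \<alpha> by (simp add: g_def)
  have \<beta>pos: "0 < \<beta>" using L gpos by (simp add: \<beta>_def)
  have E2: "E\<^sup>2 = x\<^sup>2 + y\<^sup>2" and Epos: "0 \<le> E" by (simp_all add: E_def)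
  have xy2: "(x + y)\<^sup>2 \<le> 2 * E\<^sup>2"
    unfolding E2 using sum_squares_bound[of x y] by (simp add: power2_sum)
  have "(x + y)\<^sup>2 \<le> (3 / 2 * E)\<^sup>2"
  proof -
    have "(3 / 2 * E)\<^sup>2 = 9 / 4 * E\<^sup>2" by (simp add: power_mult_distrib power_divide)
    then show ?thesis using xy2 zero_le_power2[of E] by linarith
  qed
  then have xy: "x + y \<le> 3 / 2 * E" by (rule power2_le_imp_le) (use Epos in simp)
  have Ppos: "0 \<le> P" and Zpos: "0 \<le> Z" by (simp_all add: P_def Z_def)
  have P2: "P\<^sup>2 = q\<^sup>2 + r\<^sup>2 + d\<^sup>2" by (simp add: P_def norm_Pair)
  have comp: "q \<le> P" "r \<le> P" "d \<le> P"
    by (rule power2_le_imp_le[OF _ Ppos], simp add: P2)+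
  have Lrq: "(L * r + q)\<^sup>2 \<le> (1 + L\<^sup>2) * (r\<^sup>2 + q\<^sup>2)"
  proof -
    have "0 \<le> (r - L * q)\<^sup>2" by simp
    then show ?thesis by (simp add: power2_eq_square algebra_simps)
  qed
  \<comment> \<open>\<open>(ns, y, nl)\<close> is dominated by the sum of a vector in the energy, one in the data and one in the
    boundary values.\<close>
  define A where "A = g * L * (x + y)"
  have A: "norm (A, y, A) \<le> g * (1 + 9 / 4 * L) * E"
  proof (rule power2_le_imp_le)
    have "(norm (A, y, A))\<^sup>2 = 2 * (g * L)\<^sup>2 * (x + y)\<^sup>2 + y\<^sup>2"
      by (simp add: norm_Pair A_def power_mult_distrib)
    also have "\<dots> \<le> 2 * (g * L)\<^sup>2 * (2 * E\<^sup>2) + (g * (1 + L))\<^sup>2 * E\<^sup>2"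
    proof (intro add_mono mult_left_mono xy2)
      have "y\<^sup>2 \<le> 1 * E\<^sup>2" by (simp add: E2)
      also have "\<dots> \<le> (g * (1 + L))\<^sup>2 * E\<^sup>2" using g by (intro mult_right_mono) auto
      finally show "y\<^sup>2 \<le> (g * (1 + L))\<^sup>2 * E\<^sup>2" .
    qed auto
    also have "\<dots> = g\<^sup>2 * (4 * L\<^sup>2 + (1 + L)\<^sup>2) * E\<^sup>2" by (simp add: power2_eq_square algebra_simps)
    also have "\<dots> \<le> g\<^sup>2 * (1 + 9 / 4 * L)\<^sup>2 * E\<^sup>2"
    proof (intro mult_left_mono mult_right_mono)
      have "(1 + 9 / 4 * L)\<^sup>2 - (4 * L\<^sup>2 + (1 + L)\<^sup>2) = 5 / 2 * L + 1 / 16 * L\<^sup>2"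
        by (simp add: power2_eq_square algebra_simps)
      also have "0 \<le> \<dots>" using L by simp
      finally show "4 * L\<^sup>2 + (1 + L)\<^sup>2 \<le> (1 + 9 / 4 * L)\<^sup>2" by simp
    qed auto
    finally show "(norm (A, y, A))\<^sup>2 \<le> (g * (1 + 9 / 4 * L) * E)\<^sup>2" by (simp add: power_mult_distrib)
  qed (use gpos L Epos in simp)
  have G: "norm (g * d, 0::real, g * (L * r + q)) \<le> g * (1 + L) * P"
  proof (rule power2_le_imp_le)
    have "(norm (g * d, 0::real, g * (L * r + q)))\<^sup>2 = g\<^sup>2 * (d\<^sup>2 + (L * r + q)\<^sup>2)"
      unfolding distrib_left[of "g\<^sup>2"] by (simp add: norm_Pair power_mult_distrib)
    also have "\<dots> \<le> g\<^sup>2 * ((1 + L)\<^sup>2 * P\<^sup>2)"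
    proof (rule mult_left_mono)
      have "(1 + L\<^sup>2) * P\<^sup>2 = d\<^sup>2 + (1 + L\<^sup>2) * (r\<^sup>2 + q\<^sup>2) + L\<^sup>2 * d\<^sup>2"
        unfolding P2 by (simp add: algebra_simps)
      moreover have "0 \<le> L\<^sup>2 * d\<^sup>2" by simp
      ultimately have "d\<^sup>2 + (L * r + q)\<^sup>2 \<le> (1 + L\<^sup>2) * P\<^sup>2"
        using Lrq by linarith
      also have "\<dots> \<le> (1 + L)\<^sup>2 * P\<^sup>2"
        using L by (intro mult_right_mono) (auto simp: power2_sum)
      finally show "d\<^sup>2 + (L * r + q)\<^sup>2 \<le> (1 + L)\<^sup>2 * P\<^sup>2" .
    qed simp
    finally show "(norm (g * d, 0::real, g * (L * r + q)))\<^sup>2 \<le> (g * (1 + L) * P)\<^sup>2"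
      by (simp add: power_mult_distrib ac_simps)
  qed (use gpos L Ppos in simp)
  have S: "norm (\<beta> * \<sigma>, 0::real, \<beta> * \<xi>) \<le> \<beta> * (\<sigma> + \<xi>)"
  proof (rule power2_le_imp_le)
    show "(norm (\<beta> * \<sigma>, 0::real, \<beta> * \<xi>))\<^sup>2 \<le> (\<beta> * (\<sigma> + \<xi>))\<^sup>2"
      using pos \<beta>pos by (simp add: norm_Pair power_mult_distrib power2_sum distrib_left)
  qed (use pos \<beta>pos in simp)
  have "Z \<le> norm (A + g * d + \<beta> * \<sigma>, y + 0 + 0, A + g * (L * r + q) + \<beta> * \<xi>)"
    unfolding Z_def using ns nl pos by (intro norm_triple_mono) (auto simp: A_def algebra_simps)
  also have "\<dots> = norm ((A, y, A) + (g * d, 0, g * (L * r + q)) + (\<beta> * \<sigma>, 0, \<beta> * \<xi>))" by simp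
  also have "\<dots> \<le> norm (A, y, A) + norm (g * d, 0::real, g * (L * r + q)) + norm (\<beta> * \<sigma>, 0::real, \<beta> * \<xi>)"
    by (intro norm_triangle_le add_right_mono norm_triangle_ineq)
  also have "\<dots> \<le> g * (1 + 9 / 4 * L) * E + g * (1 + L) * P + \<beta> * (\<sigma> + \<xi>)"
    using A G S by linarith
  finally have Zle: "Z \<le> g * (1 + 9 / 4 * L) * E + g * (1 + L) * P + \<beta> * (\<sigma> + \<xi>)" .

  have "\<xi> * sT + \<sigma> * l0 \<le> \<xi> * (L * \<sigma> + \<beta> * (L * x + L * y + d)) + \<sigma> * (L * \<xi> + \<beta> * (L * y + L * r + q + L * x))"
    using pos sT l0 by (intro add_mono mult_left_mono)
  also have "\<dots> = 2 * L * (\<sigma> * \<xi>) + \<beta> * L * (x + y) * (\<sigma> + \<xi>) + \<beta> * (\<xi> * d + \<sigma> * (L * r + q))"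
    by (simp add: algebra_simps)
  also have "\<dots> \<le> (3 / 8 * (1 + L) * (\<sigma> + \<xi>))\<^sup>2 + \<beta> * L * (3 / 2 * E) * (\<sigma> + \<xi>) + \<beta> * ((1 + L) * P * (\<sigma> + \<xi>))"
  proof (intro add_mono mult_left_mono mult_right_mono xy)
    have "2 * L * (\<sigma> * \<xi>) \<le> L / 2 * (\<sigma> + \<xi>)\<^sup>2"
      using mult_left_mono[OF sum_squares_bound[of \<sigma> \<xi>], of "L / 2"] L by (simp add: power2_sum algebra_simps)
    also have "\<dots> \<le> (3 / 8 * (1 + L))\<^sup>2 * (\<sigma> + \<xi>)\<^sup>2"
    proof (rule mult_right_mono)
      have "4 * L \<le> (1 + L)\<^sup>2" using sum_squares_bound[of 1 L] by (simp add: power2_sum)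
      moreover have "(3 / 8 * (1 + L))\<^sup>2 = 9 / 64 * (1 + L)\<^sup>2"
        by (simp only: power_mult_distrib) (simp add: power_divide)
      ultimately show "L / 2 \<le> (3 / 8 * (1 + L))\<^sup>2" using L by linarith
    qed simp
    finally show "2 * L * (\<sigma> * \<xi>) \<le> (3 / 8 * (1 + L) * (\<sigma> + \<xi>))\<^sup>2"
      by (simp only: power_mult_distrib)
    have "d \<le> (1 + L) * P" using comp Ppos L mult_right_mono[of 1 "1 + L" P] by simp
    moreover have "L * r + q \<le> (1 + L) * P"
    proof -
      have "L * r \<le> L * P" using comp(2) L by (intro mult_left_mono) auto
      then show ?thesis unfolding distrib_right using comp(1) by linarith
    qed
    ultimately have "\<xi> * d + \<sigma> * (L * r + q) \<le> \<xi> * ((1 + L) * P) + \<sigma> * ((1 + L) * P)"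
      using pos by (intro add_mono mult_left_mono)
    then show "\<xi> * d + \<sigma> * (L * r + q) \<le> (1 + L) * P * (\<sigma> + \<xi>)" by (simp add: algebra_simps)
  qed (use pos \<beta>pos L in auto)
  finally have "E\<^sup>2 \<le> (3 / 2 * \<beta> * L) * (\<sigma> + \<xi>) * E + (3 / 8 * (1 + L) * (\<sigma> + \<xi>))\<^sup>2
      + (\<beta> * (1 + L)) * P * (\<sigma> + \<xi>) + P * Z"
    using energy unfolding E2 by (simp add: ac_simps)
  from absorb_quadratic[OF this Zle]
  have "Z \<le> ((g * (1 + 9 / 4 * L))\<^sup>2 + 2 * (g * (1 + L))) * P
     + (2 * \<beta> + 2 * (g * (1 + 9 / 4 * L)) * (3 / 2 * \<beta> * L) + 2 * (g * (1 + 9 / 4 * L)) * (3 / 8 * (1 + L))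
      + \<beta> * (1 + L)) * (\<sigma> + \<xi>)"
    using pos \<beta>pos L gpos Ppos Zpos by simp
  also have "\<dots> \<le> (2 * decay_const L \<alpha>) * P + (4 * decay_const L \<alpha>) * (\<sigma> + \<xi>)"
    using gain_le_decay_const[OF L \<alpha>] g Ppos pos unfolding \<beta>_def g_def
    by (intro add_mono mult_right_mono) auto
  finally show ?thesis .
qed

section \<open>The stationarity conditions\<close>

lemma matrix_exp_convolution_integral:
  fixes A :: "real^'n^'n" and g :: "real \<Rightarrow> real^'n"
  assumes g: "g absolutely_integrable_on {0..T}" and "0 \<le> x" "y \<le> T" and h: "continuous_on UNIV h"
  shows "(LINT \<tau>:{x..y}|lebesgue. matrix_exp (h \<tau> *\<^sub>R A) *v g \<tau>)
      = integral {x..y} (\<lambda>\<tau>. matrix_exp (h \<tau> *\<^sub>R A) *v g \<tau>)"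
    and "(\<lambda>\<tau>. matrix_exp (h \<tau> *\<^sub>R A) *v g \<tau>) integrable_on {x..y}"
proof -
  have "g absolutely_integrable_on {x..y}"
    using g by (rule set_integrable_subset) (use assms in auto)
  then have "(\<lambda>\<tau>. matrix_exp (h \<tau> *\<^sub>R A) *v g \<tau>) absolutely_integrable_on {x..y}"
    by (rule absolutely_integrable_bounded_bilinear[OF bounded_bilinear_matrix_vector, rotated])
      (intro continuous_on_matrix_exp continuous_on_subset[OF h] subset_UNIV)
  then show "(LINT \<tau>:{x..y}|lebesgue. matrix_exp (h \<tau> *\<^sub>R A) *v g \<tau>)
      = integral {x..y} (\<lambda>\<tau>. matrix_exp (h \<tau> *\<^sub>R A) *v g \<tau>)"
    "(\<lambda>\<tau>. matrix_exp (h \<tau> *\<^sub>R A) *v g \<tau>) integrable_on {x..y}"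
    by (simp_all only: set_lebesgue_integral_eq_integral)
qed

text \<open>The mild equations are equivalent to the differential ones in integrated form; here is the
  direction that the estimates need. For \<open>l\<close> the mild formula is read backwards in time.\<close>

lemma mild_solution_stationary:
  fixes \<Lambda> :: "real^'s^'s" and B :: "real^'u^'s" and C :: "real^'s^'y"
  assumes T: "0 \<le> T" and p: "L2_on {0..T} (\<lambda>t. (q t, r t, d t))"
    and mild: "mild_solution T \<Lambda> B C q r d s\<^sub>0 l\<^sub>T s u l"
  shows "primitive_on T s (\<lambda>t. \<Lambda> *v s t + (B *v u t + d t))"
    and "primitive_on T l (\<lambda>t. - (transpose \<Lambda> *v l t + (q t - (transpose C ** C) *v s t)))"
    and "\<And>t. t \<in> {0..T} \<Longrightarrow> u t = r t + transpose B *v l t"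
    and "s 0 = s\<^sub>0" and "l T = l\<^sub>T"
proof -
  have S: "{0..T} \<in> sets lebesgue" by simp
  have z: "L2_on {0..T} (\<lambda>t. (s t, u t, l t))" using mild unfolding mild_solution_def by blast
  have sL: "L2_on {0..T} s" and uL: "L2_on {0..T} u" and qL: "L2_on {0..T} q" and dL: "L2_on {0..T} d"
    using p z by (auto simp: L2_on_Pair)
  define k where "k t = q t - (transpose C ** C) *v s t" for t
  define g where "g t = B *v u t + d t" for t
  have g: "g absolutely_integrable_on {0..T}"
    unfolding g_def by (intro L2_on_imp_absolutely_integrable L2_on_add L2_on_matrix uL dL S)
  have "L2_on {0..T} (\<lambda>t. (-1) *\<^sub>R ((transpose C ** C) *v s t))"
    by (intro L2_on_scale L2_on_matrix sL S)
  from L2_on_add(1)[OF S qL this] have "L2_on {0..T} k" by (simp add: k_def[abs_def])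
  then have k: "k absolutely_integrable_on {0..T}" by (rule L2_on_imp_absolutely_integrable)
  have leq: "l t = (LINT \<tau>:{t..T}|lebesgue. matrix_exp ((\<tau> - t) *\<^sub>R transpose \<Lambda>) *v k \<tau>)
      + matrix_exp ((T - t) *\<^sub>R transpose \<Lambda>) *v l\<^sub>T" 
    and seq: "s t = matrix_exp (t *\<^sub>R \<Lambda>) *v s\<^sub>0
      + (LINT \<tau>:{0..t}|lebesgue. matrix_exp ((t - \<tau>) *\<^sub>R \<Lambda>) *v g \<tau>)"
    and ueq: "u t = r t + transpose B *v l t" if "t \<in> {0..T}" for t
    using mild that unfolding mild_solution_def k_def g_def by blast+
  show "u t = r t + transpose B *v l t" if "t \<in> {0..T}" for t using ueq[OF that] .
  have seq': "s t = matrix_exp (t *\<^sub>R \<Lambda>) *v s\<^sub>0 + integral {0..t} (\<lambda>\<tau>. matrix_exp ((t - \<tau>) *\<^sub>R \<Lambda>) *v g \<tau>)"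
    if t: "t \<in> {0..T}" for t
    unfolding seq[OF t]
    by (subst matrix_exp_convolution_integral(1)[OF g]) (use t in \<open>auto intro: continuous_intros\<close>)
  have "l (T - t) = matrix_exp (t *\<^sub>R transpose \<Lambda>) *v l\<^sub>T
      + integral {0..t} (\<lambda>\<tau>. matrix_exp ((t - \<tau>) *\<^sub>R transpose \<Lambda>) *v k (T - \<tau>))" if t: "t \<in> {0..T}" for t
  proof -
    have c: "continuous_on UNIV (\<lambda>\<tau>. \<tau> - (T - t))" by (intro continuous_intros)
    have le: "0 \<le> T - t" using t by simp
    have eq: "(LINT \<tau>:{T - t..T}|lebesgue. matrix_exp ((\<tau> - (T - t)) *\<^sub>R transpose \<Lambda>) *v k \<tau>)
       = integral {T - t..T} (\<lambda>\<tau>. matrix_exp ((\<tau> - (T - t)) *\<^sub>R transpose \<Lambda>) *v k \<tau>)"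
      by (rule matrix_exp_convolution_integral(1)[OF k le order_refl c])
    have int: "(\<lambda>\<tau>. matrix_exp ((\<tau> - (T - t)) *\<^sub>R transpose \<Lambda>) *v k \<tau>) integrable_on {T - t..T}"
      by (rule matrix_exp_convolution_integral(2)[OF k le order_refl c])
    have "integral {0..t} (\<lambda>\<tau>. matrix_exp ((t - \<tau>) *\<^sub>R transpose \<Lambda>) *v k (T - \<tau>))
        = integral {T - t..T} (\<lambda>\<tau>. matrix_exp ((\<tau> - (T - t)) *\<^sub>R transpose \<Lambda>) *v k \<tau>)"
      using integral_unique[OF has_integral_reverse[OF integrable_integral[OF int], of T]]
      by (simp add: algebra_simps)
    then show ?thesis using leq[of "T - t"] t eq by simp
  qed
  from mild_imp_primitive[OF absolutely_integrable_reverse[OF k] T this]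
  have "primitive_on T (\<lambda>t. l (T - t)) (\<lambda>t. transpose \<Lambda> *v l (T - t) + k (T - t))" .
  from primitive_on_reverse[OF this]
  have "primitive_on T l (\<lambda>t. - (transpose \<Lambda> *v l t + k t))" by simp
  then show "primitive_on T l (\<lambda>t. - (transpose \<Lambda> *v l t + (q t - (transpose C ** C) *v s t)))"
    by (simp add: k_def)
  from mild_imp_primitive[OF g T seq']
  show "primitive_on T s (\<lambda>t. \<Lambda> *v s t + (B *v u t + d t))"
    unfolding g_def .
  show "s 0 = s\<^sub>0" using seq'[of 0] T by simp
  have "(LINT \<tau>:{T..T}|lebesgue. matrix_exp ((\<tau> - T) *\<^sub>R transpose \<Lambda>) *v k \<tau>) = 0"
    by (subst matrix_exp_convolution_integral(1)[OF k T]) (auto intro: continuous_intros)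
  then show "l T = l\<^sub>T" using leq[of T] T by simp
qed

text \<open>In the derivative of \<open>\<langle>s, l\<rangle>\<close> the terms with \<open>\<Lambda>\<close> cancel, and \<open>\<langle>B u, l\<rangle> = \<langle>u, u - r\<rangle>\<close>. So
  \<open>|C s|\<^sup>2 + |u|\<^sup>2\<close> is this derivative plus \<open>\<langle>(q, r, d), (s, u, - l)\<rangle>\<close>.\<close>

lemma stationarity_energy:
  fixes \<Lambda> :: "real^'s^'s" and B :: "real^'u^'s" and C :: "real^'s^'y"
  assumes T: "0 \<le> T"
    and s: "primitive_on T s (\<lambda>t. \<Lambda> *v s t + (B *v u t + d t))"
    and l: "primitive_on T l (\<lambda>t. - (transpose \<Lambda> *v l t + (q t - (transpose C ** C) *v s t)))"
    and u: "\<And>t. t \<in> {0..T} \<Longrightarrow> u t = r t + transpose B *v l t"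
    and p: "L2_on {0..T} (\<lambda>t. (q t, r t, d t))" and z: "L2_on {0..T} (\<lambda>t. (s t, u t, l t))"
  shows "(L2_norm_on {0..T} (\<lambda>t. C *v s t))\<^sup>2 + (L2_norm_on {0..T} u)\<^sup>2 \<le>
    norm (l T) * norm (s T) + norm (s 0) * norm (l 0)
    + L2_norm_on {0..T} (\<lambda>t. (q t, r t, d t)) * L2_norm_on {0..T} (\<lambda>t. (s t, u t, l t))"
proof -
  let ?S = "{0..T}" and ?p = "\<lambda>t. (q t, r t, d t)" and ?z = "\<lambda>t. (s t, u t, l t)"
  have S: "?S \<in> sets lebesgue" by simp
  have sL: "L2_on ?S s" and uL: "L2_on ?S u" using z by (auto simp: L2_on_Pair)
  note CsL = L2_on_matrix(1)[OF S sL, of C]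
  let ?e = "\<lambda>t. (\<Lambda> *v s t + (B *v u t + d t)) \<bullet> l t
      + s t \<bullet> - (transpose \<Lambda> *v l t + (q t - (transpose C ** C) *v s t))"
  have I: "(?e has_integral (s T \<bullet> l T - s 0 \<bullet> l 0)) ?S"
    using primitive_on_increment[OF primitive_on_product[OF bounded_bilinear_inner s l], of 0 T] T by simp
  have pz: "(\<lambda>t. norm (?p t) * norm (?z t)) integrable_on ?S"
    by (rule L2_on_product_integrable[OF S p z])
  have le: "(norm (C *v s t))\<^sup>2 + (norm (u t))\<^sup>2 \<le> ?e t + norm (?p t) * norm (?z t)" if t: "t \<in> ?S" for t
  proof -
    have a: "(\<Lambda> *v s t) \<bullet> l t = s t \<bullet> (transpose \<Lambda> *v l t)"
      by (metis inner_commute inner_transpose)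
    have b: "(B *v u t) \<bullet> l t = u t \<bullet> (u t - r t)"
      using u[OF t] by (metis add_diff_cancel_left' inner_commute inner_transpose)
    have c: "s t \<bullet> ((transpose C ** C) *v s t) = (norm (C *v s t))\<^sup>2"
      by (metis inner_commute inner_transpose matrix_vector_mul_assoc power2_norm_eq_inner)
    have "(norm (C *v s t))\<^sup>2 + (norm (u t))\<^sup>2 = ?e t + (q t, r t, d t) \<bullet> (s t, u t, - l t)"
      unfolding inner_add_left inner_minus_right inner_add_right inner_diff_right a b c
      by (simp add: power2_norm_eq_inner inner_commute)
    also have "(q t, r t, d t) \<bullet> (s t, u t, - l t) \<le> norm (?p t) * norm (s t, u t, - l t)"
      by (rule norm_cauchy_schwarz)
    also have "norm (s t, u t, - l t) = norm (?z t)" by (simp add: norm_Pair)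
    finally show ?thesis by simp
  qed
  have "(L2_norm_on ?S (\<lambda>t. C *v s t))\<^sup>2 + (L2_norm_on ?S u)\<^sup>2
      = integral ?S (\<lambda>t. (norm (C *v s t))\<^sup>2 + (norm (u t))\<^sup>2)"
    using CsL uL by (simp add: L2_norm_on_square L2_on_iff Henstock_Kurzweil_Integration.integral_add)
  also have "\<dots> \<le> integral ?S (\<lambda>t. ?e t + norm (?p t) * norm (?z t))"
  proof (rule integral_le[OF _ _ le])
    show "(\<lambda>t. (norm (C *v s t))\<^sup>2 + (norm (u t))\<^sup>2) integrable_on ?S"
      using CsL uL by (intro integrable_add) (auto simp: L2_on_iff)
    show "(\<lambda>t. ?e t + norm (?p t) * norm (?z t)) integrable_on ?S"
      using has_integral_integrable[OF I] pz by (rule integrable_add)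
  qed
  also have "\<dots> = (s T \<bullet> l T - s 0 \<bullet> l 0) + integral ?S (\<lambda>t. norm (?p t) * norm (?z t))"
    using has_integral_add[OF I integrable_integral[OF pz]] by (rule integral_unique)
  also have "\<dots> \<le> (norm (l T) * norm (s T) + norm (s 0) * norm (l 0)) + L2_norm_on ?S ?p * L2_norm_on ?S ?z"
    using L2_Cauchy_Schwarz[OF S p z] norm_cauchy_schwarz[of "s T" "l T"] norm_cauchy_schwarz[of "- s 0" "l 0"]
    by (simp add: mult.commute)
  finally show ?thesis .
qed

text \<open>Output injection and state feedback rewrite the two differential equations as stable ones whose
  forcing contains the solution only through \<open>C s\<close> and \<open>u\<close>, the quantities in the energy.\<close>

lemma stationarity_L2_estimate:
  fixes \<Lambda> :: "real^'s^'s" and B :: "real^'u^'s" and C :: "real^'s^'y"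
  assumes T: "0 \<le> T" and L: "1 \<le> L" and \<alpha>: "0 < \<alpha>"
    and nrm: "spectral_norm \<Lambda> \<le> L" "spectral_norm B \<le> L" "spectral_norm C \<le> L"
    and stab: "stabilizable L \<alpha> \<Lambda> B" and det: "detectable L \<alpha> \<Lambda> C"
    and s: "primitive_on T s (\<lambda>t. \<Lambda> *v s t + (B *v u t + d t))"
    and l: "primitive_on T l (\<lambda>t. - (transpose \<Lambda> *v l t + (q t - (transpose C ** C) *v s t)))"
    and u: "\<And>t. t \<in> {0..T} \<Longrightarrow> u t = r t + transpose B *v l t"
    and p: "L2_on {0..T} (\<lambda>t. (q t, r t, d t))" and z: "L2_on {0..T} (\<lambda>t. (s t, u t, l t))"
  shows "L2_norm_on {0..T} (\<lambda>t. (s t, u t, l t)) \<le>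
    2 * decay_const L \<alpha> * L2_norm_on {0..T} (\<lambda>t. (q t, r t, d t))
    + 4 * decay_const L \<alpha> * (norm (s 0) + norm (l T))"
proof -
  let ?S = "{0..T}" and ?p = "\<lambda>t. (q t, r t, d t)" and ?z = "\<lambda>t. (s t, u t, l t)"
  let ?N = "L2_norm_on {0..T}"
  have S: "?S \<in> sets lebesgue" by simp
  have sL: "L2_on ?S s" and uL: "L2_on ?S u" and lL: "L2_on ?S l"
    and qL: "L2_on ?S q" and rL: "L2_on ?S r" and dL: "L2_on ?S d"
    using p z by (auto simp: L2_on_Pair)
  have Zeq: "?N ?z = norm (?N s, ?N u, ?N l)" and Peq: "?N ?p = norm (?N q, ?N r, ?N d)"
    using sL uL lL qL rL dL
    by (auto simp: norm_Pair L2_on_Pair simp flip: L2_on_Pair(2) intro!: real_sqrt_unique[symmetric])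
  obtain K1 :: "real^'y^'s" where K1: "spectral_norm K1 \<le> L" "stable L \<alpha> (\<Lambda> - K1 ** C)"
    using det unfolding detectable_def by blast
  obtain K2 :: "real^'s^'u" where K2: "spectral_norm K2 \<le> L" "stable L \<alpha> (\<Lambda> - B ** K2)"
    using stab unfolding stabilizable_def by blast
  have \<alpha>le: "\<alpha> \<le> L * (1 + L)"
    using stable_rate_le_spectral_norm[OF K2(2)] spectral_norm_closed_loop[OF nrm(1,2) K2(1)] by simp
  have g: "1 \<le> L / \<alpha> * (1 + L)" using \<alpha>le \<alpha> by simp
  \<comment> \<open>The factor of the boundary values becomes comparable with \<open>L / \<alpha>\<close>.\<close>
  have \<beta>: "L / sqrt (2 * \<alpha>) \<le> 3 / 4 * (L / \<alpha>) * (1 + L)"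
  proof (rule power2_le_imp_le)
    have "9 / 8 * (1 + L)\<^sup>2 - L * (1 + L) = 1 / 8 * L\<^sup>2 + (5 / 4 * L + 9 / 8)"
      by (simp add: power2_eq_square algebra_simps)
    also have "0 \<le> \<dots>" using L by (intro add_nonneg_nonneg) auto
    finally have "\<alpha> \<le> 9 / 8 * (1 + L)\<^sup>2" using \<alpha>le by simp
    then have "L\<^sup>2 * \<alpha> \<le> L\<^sup>2 * (9 / 8 * (1 + L)\<^sup>2)" by (rule mult_left_mono) simp
    have "(L / sqrt (2 * \<alpha>))\<^sup>2 = L\<^sup>2 * \<alpha> / (2 * \<alpha>\<^sup>2)"
      using \<alpha> by (simp add: power_divide power2_eq_square)
    also have "\<dots> \<le> L\<^sup>2 * (9 / 8 * (1 + L)\<^sup>2) / (2 * \<alpha>\<^sup>2)"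
      using \<open>L\<^sup>2 * \<alpha> \<le> _\<close> by (rule divide_right_mono) simp
    also have "\<dots> = (3 / 4 * (L / \<alpha>) * (1 + L))\<^sup>2"
      by (simp add: power_divide power_mult_distrib)
    finally show "(L / sqrt (2 * \<alpha>))\<^sup>2 \<le> (3 / 4 * (L / \<alpha>) * (1 + L))\<^sup>2" .
  qed (use L \<alpha> in simp)
  \<comment> \<open>The output injection \<open>K1\<close> turns \<open>C s\<close> into a forcing term of a stable equation.\<close>
  define h1 where "h1 t = K1 *v (C *v s t) + B *v u t + d t" for t
  have s': "primitive_on T s (\<lambda>t. (\<Lambda> - K1 ** C) *v s t + h1 t)"
    by (rule primitive_on_cong[OF s refl])
      (simp add: h1_def mv.diff_left matrix_vector_mul_assoc)
  note CsL = L2_on_matrix(1)[OF S sL, of C]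
  note KCsL = L2_on_matrix(1)[OF S CsL, of K1] and BuL = L2_on_matrix(1)[OF S uL, of B]
  have h1L: "L2_on ?S h1"
    unfolding h1_def by (intro L2_on_add KCsL BuL dL S)
  have h1: "?N h1 \<le> L * ?N (\<lambda>t. C *v s t) + L * ?N u + ?N d"
    unfolding h1_def
    using L2_on_add(2)[OF S L2_on_add(1)[OF S KCsL BuL] dL] L2_on_add(2)[OF S KCsL BuL]
      L2_norm_matrix_le[OF S CsL K1(1)] L2_norm_matrix_le[OF S uL nrm(2)] by linarith
  \<comment> \<open>The transposed feedback \<open>K2\<close> acts on \<open>B\<^sup>T l\<close>, which is \<open>u - r\<close> by the second condition.\<close>
  define h2 where "h2 t = transpose K2 *v (u t - r t) + q t + transpose C *v (- (C *v s t))" for t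
  have l': "primitive_on T l (\<lambda>t. - (transpose (\<Lambda> - B ** K2) *v l t + h2 t))"
  proof (rule primitive_on_cong[OF l refl])
    fix t assume t: "t \<in> ?S"
    have "transpose (\<Lambda> - B ** K2) = transpose \<Lambda> - transpose K2 ** transpose B"
      unfolding matrix_transpose_mul[symmetric] by (simp add: transpose_def vec_eq_iff)
    then show "- (transpose (\<Lambda> - B ** K2) *v l t + h2 t) = - (transpose \<Lambda> *v l t + (q t - (transpose C ** C) *v s t))"
      using u[OF t] by (simp add: h2_def mv.diff_left mv.minus_right matrix_vector_mul_assoc del: transpose_matrix_vector)
  qed
  have KT: "spectral_norm (transpose K2) \<le> L" and CT: "spectral_norm (transpose C) \<le> L"
    using K2(1) nrm(3) spectral_norm_transpose_le order_trans by blast+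
  have rL': "L2_on ?S (\<lambda>t. - r t)" "?N (\<lambda>t. - r t) = ?N r"
    using L2_on_scale[OF S rL, of "-1"] by auto
  have urL: "L2_on ?S (\<lambda>t. u t - r t)" "?N (\<lambda>t. u t - r t) \<le> ?N u + ?N r"
    using L2_on_add[OF S uL rL'(1)] rL'(2) by auto
  have CsL': "L2_on ?S (\<lambda>t. - (C *v s t))" "?N (\<lambda>t. - (C *v s t)) = ?N (\<lambda>t. C *v s t)"
    using L2_on_scale[OF S CsL, of "-1"] by auto
  note KurL = L2_on_matrix(1)[OF S urL(1), of "transpose K2"]
  note CCsL = L2_on_matrix(1)[OF S CsL'(1), of "transpose C"]
  have h2L: "L2_on ?S h2"
    unfolding h2_def by (intro L2_on_add KurL qL CCsL S)
  have h2: "?N h2 \<le> L * ?N u + L * ?N r + ?N q + L * ?N (\<lambda>t. C *v s t)"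
  proof -
    have "L * ?N (\<lambda>t. u t - r t) \<le> L * ?N u + L * ?N r"
      using mult_left_mono[OF urL(2), of L] L by (simp add: distrib_left)
    then show ?thesis
      unfolding h2_def
      using L2_on_add(2)[OF S L2_on_add(1)[OF S KurL qL] CCsL] L2_on_add(2)[OF S KurL qL]
        L2_norm_matrix_le[OF S urL(1) KT] L2_norm_matrix_le[OF S CsL'(1) CT]
      unfolding CsL'(2) by linarith
  qed
  have Lpos: "0 \<le> L" using L by simp
  note d1 = stable_decay[OF K1(2) \<alpha> Lpos T s' h1L]
    and d2 = stable_decay_backward[OF stable_transpose[OF K2(2)] \<alpha> Lpos T l' h2L]
  let ?\<beta> = "3 / 4 * (L / \<alpha>) * (1 + L)"
  have mono: "g * h + b * n \<le> g * h' + b' * n" "L * n + b * h \<le> L * n + b' * h'"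
    if "0 \<le> g" "h \<le> h'" "b \<le> b'" "0 \<le> n" "0 \<le> h" "0 \<le> b'" for g h h' b b' n :: real
    using that by (auto intro!: add_mono mult_left_mono mult_right_mono mult_mono)
  have gp: "0 \<le> L / \<alpha>" and \<beta>p: "0 \<le> ?\<beta>" using L \<alpha> by auto
  show ?thesis
    unfolding Zeq Peq
  proof (rule saddle_point_bound[where x = "?N (\<lambda>t. C *v s t)" and sT = "norm (s T)" and ?l0.0 = "norm (l 0)"])
    show "?N s \<le> L / \<alpha> * (L * ?N (\<lambda>t. C *v s t) + L * ?N u + ?N d) + ?\<beta> * norm (s 0)"
      by (rule order_trans[OF d1(1) mono(1)[OF gp h1 \<beta>]]) (use \<beta>p in auto)
    show "?N l \<le> L / \<alpha> * (L * ?N u + L * ?N r + ?N q + L * ?N (\<lambda>t. C *v s t)) + ?\<beta> * norm (l T)"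
      by (rule order_trans[OF d2(1) mono(1)[OF gp h2 \<beta>]]) (use \<beta>p in auto)
    show "norm (s T) \<le> L * norm (s 0) + ?\<beta> * (L * ?N (\<lambda>t. C *v s t) + L * ?N u + ?N d)"
      by (rule order_trans[OF d1(2) mono(2)[OF gp h1 \<beta>]]) (use \<beta>p in auto)
    show "norm (l 0) \<le> L * norm (l T) + ?\<beta> * (L * ?N u + L * ?N r + ?N q + L * ?N (\<lambda>t. C *v s t))"
      by (rule order_trans[OF d2(2) mono(2)[OF gp h2 \<beta>]]) (use \<beta>p in auto)
    show "(?N (\<lambda>t. C *v s t))\<^sup>2 + (?N u)\<^sup>2 \<le> norm (l T) * norm (s T) + norm (s 0) * norm (l 0)
        + norm (?N q, ?N r, ?N d) * norm (?N s, ?N u, ?N l)"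
      using stationarity_energy[OF T s l u p z] unfolding Zeq Peq .
  qed (use L \<alpha> g in auto)
qed

section \<open>Exponential weights\<close>

text \<open>For a weight with \<open>w' = \<psi> w\<close> the function \<open>w z\<close> solves the stationarity conditions with the data
  \<open>w p + w' (- l, 0, s)\<close>. The bound on \<open>\<psi>\<close> makes the additional term contribute at most
  \<open>2 D \<parallel>w z\<parallel> / (4 D) = \<parallel>w z\<parallel> / 2\<close>, which is moved to the left-hand side.\<close>

lemma weighted_stationarity_estimate:
  fixes \<Lambda> :: "real^'s^'s" and B :: "real^'u^'s" and C :: "real^'s^'y"
    and L \<alpha> :: real
  defines "D \<equiv> decay_const L \<alpha>"
  assumes T: "0 \<le> T" and L: "1 \<le> L" and \<alpha>: "0 < \<alpha>"
    and nrm: "spectral_norm \<Lambda> \<le> L" "spectral_norm B \<le> L" "spectral_norm C \<le> L"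
    and stab: "stabilizable L \<alpha> \<Lambda> B" and det: "detectable L \<alpha> \<Lambda> C"
    and s: "primitive_on T s (\<lambda>t. \<Lambda> *v s t + (B *v u t + d t))"
    and l: "primitive_on T l (\<lambda>t. - (transpose \<Lambda> *v l t + (q t - (transpose C ** C) *v s t)))"
    and u: "\<And>t. t \<in> {0..T} \<Longrightarrow> u t = r t + transpose B *v l t"
    and p: "L2_on {0..T} (\<lambda>t. (q t, r t, d t))" and z: "L2_on {0..T} (\<lambda>t. (s t, u t, l t))"
    and w: "primitive_on T w (\<lambda>t. \<psi> t * w t)"
    and w01: "\<And>t. 0 \<le> w t" "\<And>t. w t \<le> 1"
    and \<psi>: "\<And>t. \<bar>\<psi> t\<bar> \<le> 1 / (4 * D)"
  shows "L2_norm_on {0..T} (\<lambda>t. w t *\<^sub>R (s t, u t, l t)) \<le>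
    4 * D * L2_norm_on {0..T} (\<lambda>t. w t *\<^sub>R (q t, r t, d t)) + 8 * D * (w 0 * norm (s 0) + w T * norm (l T))"
proof -
  let ?S = "{0..T}"
  let ?z = "\<lambda>t. (w t *\<^sub>R s t, w t *\<^sub>R u t, w t *\<^sub>R l t)"
  let ?wp = "\<lambda>t. (w t *\<^sub>R q t, w t *\<^sub>R r t, w t *\<^sub>R d t)"
  let ?c = "\<lambda>t. (- (\<psi> t * w t) *\<^sub>R l t, 0 :: real^'u, (\<psi> t * w t) *\<^sub>R s t)"
  have S: "?S \<in> sets lebesgue" by simp
  have D: "0 < D" unfolding D_def by (rule decay_const_pos[OF L \<alpha>])
  have wm: "w \<in> borel_measurable (lebesgue_on ?S)"
    using primitive_on_continuous[OF w] by (rule continuous_imp_measurable_on_sets_lebesgue) simp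
  have \<psi>wm: "(\<lambda>t. \<psi> t * w t) \<in> borel_measurable (lebesgue_on ?S)"
    using w by (simp add: primitive_on_def absolutely_integrable_measurable)
  note w_L2 = L2_on_weighted[OF S wm w01]
  have zL: "L2_on ?S ?z" and wpL: "L2_on ?S ?wp" using w_L2[OF z] w_L2[OF p] by auto
  have cm: "?c \<in> borel_measurable (lebesgue_on ?S)"
    using z \<psi>wm by (intro borel_measurable_Pair borel_measurable_scaleR borel_measurable_uminus)
      (auto simp: L2_on_Pair L2_on_iff)
  have cle: "norm (?c t) \<le> 1 / (4 * D) * norm (?z t)" for t
  proof (rule power2_le_imp_le)
    have "(norm (?c t))\<^sup>2 = \<bar>\<psi> t\<bar>\<^sup>2 * ((norm (w t *\<^sub>R l t))\<^sup>2 + (norm (w t *\<^sub>R s t))\<^sup>2)"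
      by (simp add: norm_Pair power_mult_distrib algebra_simps)
    also have "\<dots> \<le> (1 / (4 * D))\<^sup>2 * (norm (?z t))\<^sup>2"
      using \<psi> by (intro mult_mono power_mono) (auto simp: norm_Pair)
    finally show "(norm (?c t))\<^sup>2 \<le> (1 / (4 * D) * norm (?z t))\<^sup>2" by (simp only: power_mult_distrib)
  qed (use D in simp)
  have cL: "L2_on ?S ?c" and cN: "L2_norm_on ?S ?c \<le> 1 / (4 * D) * L2_norm_on ?S ?z"
    using L2_on_scaled_bound[OF S cm zL _ cle] D by auto
  let ?q = "\<lambda>t. w t *\<^sub>R q t + - (\<psi> t * w t) *\<^sub>R l t" and ?d = "\<lambda>t. w t *\<^sub>R d t + (\<psi> t * w t) *\<^sub>R s t"
  have pL: "L2_on ?S (\<lambda>t. (?q t, w t *\<^sub>R r t, ?d t))"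
    using L2_on_add(1)[OF S wpL cL] by simp
  have pN: "L2_norm_on ?S (\<lambda>t. (?q t, w t *\<^sub>R r t, ?d t)) \<le> L2_norm_on ?S ?wp + 1 / (4 * D) * L2_norm_on ?S ?z"
    using L2_on_add(2)[OF S wpL cL] cN by simp
  have ws: "primitive_on T (\<lambda>t. w t *\<^sub>R s t) (\<lambda>t. \<Lambda> *v (w t *\<^sub>R s t) + (B *v (w t *\<^sub>R u t) + ?d t))"
    by (rule primitive_on_cong[OF primitive_on_product[OF bounded_bilinear_scaleR w s] refl])
      (simp add: mv.scaleR_right scaleR_right_distrib)
  have wl: "primitive_on T (\<lambda>t. w t *\<^sub>R l t)
      (\<lambda>t. - (transpose \<Lambda> *v (w t *\<^sub>R l t) + (?q t - (transpose C ** C) *v (w t *\<^sub>R s t))))"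
    by (rule primitive_on_cong[OF primitive_on_product[OF bounded_bilinear_scaleR w l] refl])
      (simp add: mv.scaleR_right scaleR_right_distrib scaleR_right_diff_distrib del: transpose_matrix_vector)
  have wu: "w t *\<^sub>R u t = w t *\<^sub>R r t + transpose B *v (w t *\<^sub>R l t)" if "t \<in> ?S" for t
    using u[OF that] by (simp add: mv.scaleR_right scaleR_right_distrib del: transpose_matrix_vector)
  have "L2_norm_on ?S ?z \<le> 2 * D * L2_norm_on ?S (\<lambda>t. (?q t, w t *\<^sub>R r t, ?d t))
      + 4 * D * (norm (w 0 *\<^sub>R s 0) + norm (w T *\<^sub>R l T))"
    unfolding D_def by (rule stationarity_L2_estimate[OF T L \<alpha> nrm stab det ws wl wu pL zL])
  also have "\<dots> \<le> 2 * D * (L2_norm_on ?S ?wp + 1 / (4 * D) * L2_norm_on ?S ?z)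
      + 4 * D * (norm (w 0 *\<^sub>R s 0) + norm (w T *\<^sub>R l T))"
    using pN D by (intro add_right_mono mult_left_mono) auto
  also have "2 * D * (L2_norm_on ?S ?wp + 1 / (4 * D) * L2_norm_on ?S ?z)
      = 2 * D * L2_norm_on ?S ?wp + L2_norm_on ?S ?z / 2"
    using D by (simp add: distrib_left)
  also have "norm (w 0 *\<^sub>R s 0) + norm (w T *\<^sub>R l T) = w 0 * norm (s 0) + w T * norm (l T)"
    using w01(1) by simp
  finally have "L2_norm_on ?S ?z \<le> 4 * D * L2_norm_on ?S ?wp + 8 * D * (w 0 * norm (s 0) + w T * norm (l T))"
    by linarith
  then show ?thesis by simp
qed

text \<open>The exponent is the distance of \<open>t\<close> to \<open>[a,b]\<close>. The weight is continuous, and differentiable except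
  possibly at \<open>a\<close> and \<open>b\<close>, where the value of \<open>\<psi>\<close> does not affect the integral.\<close>

lemma exponential_weight:
  fixes a b \<mu> :: real
  defines "w \<equiv> \<lambda>t. exp (- (\<mu> * max 0 (max (a - t) (t - b))))"
    and "\<psi> \<equiv> \<lambda>t. if t < a then \<mu> else if t \<le> b then 0 else - \<mu>"
  assumes "a \<le> b" and "0 \<le> \<mu>"
  shows "primitive_on T w (\<lambda>t. \<psi> t * w t)"
proof -
  have cont: "continuous_on X w" for X unfolding w_def by (intro continuous_intros)
  have deriv: "(w has_vector_derivative \<psi> x * w x) (at x)" if ab: "x \<notin> {a, b}" for x
  proof -
    consider "x < a" | "a < x" "x < b" | "b < x" using ab by fastforce
    then show ?thesis
    proof cases
      case 1
      have "((\<lambda>t. exp (\<mu> * (t - a))) has_real_derivative \<mu> * exp (\<mu> * (x - a))) (at x)"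
        by (auto intro!: derivative_eq_intros)
      then have "((\<lambda>t. exp (\<mu> * (t - a))) has_vector_derivative \<psi> x * w x) (at x)"
        using 1 assms by (simp add: has_real_derivative_iff_has_vector_derivative w_def \<psi>_def max_def algebra_simps)
      then show ?thesis
        by (rule has_vector_derivative_transform_within_open[where S = "{..<a}"])
          (use 1 assms in \<open>auto simp: w_def max_def algebra_simps\<close>)
    next
      case 2
      have "((\<lambda>t. 1) has_vector_derivative \<psi> x * w x) (at x)"
        using 2 by (simp add: \<psi>_def)
      then show ?thesis
        by (rule has_vector_derivative_transform_within_open[where S = "{a<..<b}"])
          (use 2 in \<open>auto simp: w_def max_def\<close>)
    next
      case 3
      have "((\<lambda>t. exp (- \<mu> * (t - b))) has_real_derivative - \<mu> * exp (- \<mu> * (x - b))) (at x)"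
        by (auto intro!: derivative_eq_intros)
      then have "((\<lambda>t. exp (- \<mu> * (t - b))) has_vector_derivative \<psi> x * w x) (at x)"
        using 3 assms by (simp add: has_real_derivative_iff_has_vector_derivative w_def \<psi>_def max_def algebra_simps)
      then show ?thesis
        by (rule has_vector_derivative_transform_within_open[where S = "{b<..}"])
          (use 3 assms in \<open>auto simp: w_def max_def algebra_simps\<close>)
    qed
  qed
  have int: "((\<lambda>t. \<psi> t * w t) has_integral (w t - w 0)) {0..t}" if "0 \<le> t" for t
    by (rule fundamental_theorem_of_calculus_interior_strong[where S = "{a, b}"])
      (use that deriv cont in auto)
  show ?thesis
  proof (cases "0 \<le> T")
    case True
    have "(\<lambda>t. \<psi> t * w t) absolutely_integrable_on {0..T}"
    proof (rule measurable_bounded_by_integrable_imp_absolutely_integrable)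
      show "(\<lambda>t. \<psi> t * w t) \<in> borel_measurable (lebesgue_on {0..T})"
        using int[OF True] by (intro integrable_imp_measurable) blast
      show "norm (\<psi> t * w t) \<le> \<mu>" for t
        using mult_mono[of "\<bar>\<psi> t\<bar>" \<mu> "w t" 1] assms(4) by (auto simp: \<psi>_def w_def abs_mult)
    qed auto
    then show ?thesis by (rule primitive_onI) (use int in auto)
  next
    case False
    then show ?thesis by (auto simp: primitive_on_def)
  qed
qed

text \<open>A point outside an interval lies on one side of all its points, so it is compared with the endpoint on that side.\<close>

lemma setdist_interval_le:
  fixes I :: "real set"
  assumes I: "is_interval I" "I \<noteq> {}" "bounded I"
  shows "setdist I {t} \<le> max 0 (max (Inf I - t) (t - Sup I))"
proof (cases "t \<in> I")
  case True
  then show ?thesis using setdist_le_dist[of t I t "{t}"] by simp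
next
  case False
  have le: "setdist I {t} \<le> \<bar>x - t\<bar>" if "x \<in> I" for x
    using setdist_le_dist[OF that, of t "{t}"] by (simp add: dist_real_def)
  have "(\<forall>x\<in>I. t < x) \<or> (\<forall>x\<in>I. x < t)"
    using False I(1) unfolding is_interval_1 by (meson linorder_not_less)
  then show ?thesis
  proof
    assume *: "\<forall>x\<in>I. t < x"
    have "setdist I {t} + t \<le> Inf I"
      by (rule cInf_greatest[OF I(2)]) (use le * in fastforce)
    then show ?thesis by linarith
  next
    assume *: "\<forall>x\<in>I. x < t"
    have "Sup I \<le> t - setdist I {t}"
      by (rule cSup_least[OF I(2)]) (use le * in fastforce)
    then show ?thesis by linarith
  qed
qed

theorem theorem4p3:
  fixes T L \<alpha> D :: real
    and \<Lambda> :: "real^'s^'s" and B :: "real^'u^'s" and C :: "real^'s^'y"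
    and I\<^sub>1 I\<^sub>2 :: "real set"
    and q d s l :: "real \<Rightarrow> real^'s" and r u :: "real \<Rightarrow> real^'u"
    and s\<^sub>0 l\<^sub>T :: "real^'s"
  defines "D \<equiv> decay_const L \<alpha>"
  assumes "T > 0" and "L \<ge> 1" and "\<alpha> > 0"
    and "spectral_norm \<Lambda> \<le> L" and "spectral_norm B \<le> L" and "spectral_norm C \<le> L"
    and "stabilizable L \<alpha> \<Lambda> B"
    and "detectable L \<alpha> \<Lambda> C"
    and "is_interval I\<^sub>1" and "I\<^sub>1 \<subseteq> {0..T}"
    and "is_interval I\<^sub>2" and "I\<^sub>2 \<subseteq> {0..T}"
    and "L2_on {0..T} (\<lambda>t. (q t, r t, d t))"
    and "mild_solution T \<Lambda> B C q r d s\<^sub>0 l\<^sub>T s u l"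
  shows "L2_norm_on I\<^sub>1 (\<lambda>t. (s t, u t, l t)) \<le>
    8 * D * (exp (- setdist I\<^sub>1 {0} / (4 * D)) * norm s\<^sub>0
           + exp (- setdist I\<^sub>1 {T} / (4 * D)) * norm l\<^sub>T
           + exp (- setdist I\<^sub>1 I\<^sub>2 / (4 * D)) * L2_norm_on I\<^sub>2 (\<lambda>t. (q t, r t, d t))
           + exp (- setdist I\<^sub>1 ({0..T} - I\<^sub>2) / (4 * D))
               * L2_norm_on ({0..T} - I\<^sub>2) (\<lambda>t. (q t, r t, d t)))"
proof -
  let ?S = "{0..T}" and ?p = "\<lambda>t. (q t, r t, d t)" and ?z = "\<lambda>t. (s t, u t, l t)"
  let ?e = "\<lambda>X. exp (- setdist I\<^sub>1 X / (4 * D))"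
  have T: "0 \<le> T" using \<open>T > 0\<close> by simp
  have S: "?S \<in> sets lebesgue" by simp
  have p: "L2_on ?S ?p" by fact
  have z: "L2_on ?S ?z" using \<open>mild_solution _ _ _ _ _ _ _ _ _ _ _ _\<close> unfolding mild_solution_def by blast
  have meas: "I \<in> sets lebesgue" if "is_interval I" "I \<subseteq> ?S" for I
  proof -
    have "bounded I" using that(2) bounded_subset[OF bounded_closed_interval] by blast
    then show ?thesis using that(1) by (intro fmeasurableD measurable_convex is_interval_convex)
  qed
  note I1 = meas[OF \<open>is_interval I\<^sub>1\<close> \<open>I\<^sub>1 \<subseteq> ?S\<close>] and I2 = meas[OF \<open>is_interval I\<^sub>2\<close> \<open>I\<^sub>2 \<subseteq> ?S\<close>]
  have D: "0 < D" unfolding D_def by (rule decay_const_pos) fact+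
  show ?thesis
  proof (cases "I\<^sub>1 = {}")
    case True
    then have "L2_norm_on I\<^sub>1 ?z = 0" by (simp add: L2_norm_on_def set_lebesgue_integral_def)
    then show ?thesis using D by simp
  next
    case False
    have bdd: "bounded I\<^sub>1" using \<open>I\<^sub>1 \<subseteq> ?S\<close> bounded_subset[OF bounded_closed_interval] by blast
    then have bb: "bdd_below I\<^sub>1" "bdd_above I\<^sub>1" by (auto intro: bounded_imp_bdd_below bounded_imp_bdd_above)
    define \<phi> where "\<phi> t = max 0 (max (Inf I\<^sub>1 - t) (t - Sup I\<^sub>1))" for t
    define w where "w t = exp (- (1 / (4 * D) * \<phi> t))" for t
    define \<psi> where "\<psi> t = (if t < Inf I\<^sub>1 then 1 / (4 * D) else if t \<le> Sup I\<^sub>1 then 0 else - (1 / (4 * D)))" for t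
    have w: "primitive_on T w (\<lambda>t. \<psi> t * w t)"
      unfolding w_def \<psi>_def \<phi>_def
      by (rule exponential_weight) (use D False bb in \<open>auto intro: cInf_le_cSup\<close>)
    have w1: "w t = 1" if "t \<in> I\<^sub>1" for t
      using cInf_lower[OF that bb(1)] cSup_upper[OF that bb(2)] by (simp add: w_def \<phi>_def max_def)
    have we: "w t \<le> ?e X" if "t \<in> X" for t X
    proof -
      have "setdist I\<^sub>1 X \<le> setdist I\<^sub>1 {t}" using that by (intro setdist_subset_right) auto
      also have "\<dots> \<le> \<phi> t" unfolding \<phi>_def by (rule setdist_interval_le) (fact | rule bdd)+
      finally show ?thesis using D by (simp add: w_def field_simps)
    qed
    have w01: "0 \<le> w t" "w t \<le> 1" for t using D by (auto simp: w_def \<phi>_def)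
    note stat = mild_solution_stationary[OF T p \<open>mild_solution _ _ _ _ _ _ _ _ _ _ _ _\<close>]
    have wm: "w \<in> borel_measurable (lebesgue_on ?S)"
      using primitive_on_continuous[OF w] by (rule continuous_imp_measurable_on_sets_lebesgue) simp
    note wL = L2_on_weighted[OF S wm w01]
    have part: "L2_norm_on A (\<lambda>t. w t *\<^sub>R ?p t) \<le> ?e A * L2_norm_on A ?p"
      if A: "A \<in> sets lebesgue" "A \<subseteq> ?S" for A
    proof (rule L2_on_scaled_bound(2)[OF A(1) _ L2_on_subset[OF S A p]])
      show "(\<lambda>t. w t *\<^sub>R ?p t) \<in> borel_measurable (lebesgue_on A)"
        using L2_on_subset[OF S A wL[OF p]] A(1) by (simp add: L2_on_iff)
      show "norm (w t *\<^sub>R ?p t) \<le> ?e A * norm (?p t)" if "t \<in> A" for t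
        using mult_right_mono[OF we[OF that], of "norm (?p t)"] w01(1)[of t] by (simp del: scaleR_Pair)
    qed simp
    have "L2_norm_on I\<^sub>1 ?z = L2_norm_on I\<^sub>1 (\<lambda>t. w t *\<^sub>R ?z t)"
      by (rule L2_norm_on_cong) (simp add: w1)
    also have "\<dots> \<le> L2_norm_on ?S (\<lambda>t. w t *\<^sub>R ?z t)"
      by (rule L2_norm_on_mono_set[OF S I1 \<open>I\<^sub>1 \<subseteq> ?S\<close> wL[OF z]])
    also have "\<dots> \<le> 4 * D * L2_norm_on ?S (\<lambda>t. w t *\<^sub>R ?p t) + 8 * D * (w 0 * norm (s 0) + w T * norm (l T))"
      unfolding D_def
    proof (rule weighted_stationarity_estimate[OF T _ _ _ _ _ _ _ stat(1,2,3) p z w w01])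
      show "\<bar>\<psi> t\<bar> \<le> 1 / (4 * decay_const L \<alpha>)" for t using D by (simp add: \<psi>_def D_def)
    qed (fact+)
    also have "\<dots> \<le> 8 * D * (?e I\<^sub>2 * L2_norm_on I\<^sub>2 ?p + ?e (?S - I\<^sub>2) * L2_norm_on (?S - I\<^sub>2) ?p)
        + 8 * D * (?e {0} * norm s\<^sub>0 + ?e {T} * norm l\<^sub>T)"
    proof (intro add_mono mult_mono)
      have "L2_norm_on ?S (\<lambda>t. w t *\<^sub>R ?p t)
          \<le> L2_norm_on I\<^sub>2 (\<lambda>t. w t *\<^sub>R ?p t) + L2_norm_on (?S - I\<^sub>2) (\<lambda>t. w t *\<^sub>R ?p t)"
        by (rule L2_norm_on_split[OF S I2 \<open>I\<^sub>2 \<subseteq> ?S\<close> wL[OF p]])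
      also have "\<dots> \<le> ?e I\<^sub>2 * L2_norm_on I\<^sub>2 ?p + ?e (?S - I\<^sub>2) * L2_norm_on (?S - I\<^sub>2) ?p"
        using I2 \<open>I\<^sub>2 \<subseteq> ?S\<close> S by (intro add_mono part sets.Diff) auto
      finally show "L2_norm_on ?S (\<lambda>t. w t *\<^sub>R ?p t)
          \<le> ?e I\<^sub>2 * L2_norm_on I\<^sub>2 ?p + ?e (?S - I\<^sub>2) * L2_norm_on (?S - I\<^sub>2) ?p" .
      show "w 0 \<le> ?e {0}" "w T \<le> ?e {T}" by (rule we, simp)+
    qed (use D w01 stat(4,5) in auto)
    finally show ?thesis by (simp add: algebra_simps)
  qed
qed

end
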